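(* Let $\sigma>1$ be an integer, $\alpha,\beta$ integers not congruent to $0$ modulo $\sigma$, $\omega$ a primitive $\sigma$-th root of unity, $G$ a matrix of rank $r$ with column set $E$, and $\mathbb{A}$ of order $q$, in the setting described in the context. For $k=0,\dots,\sigma-1$ let $\mathcal{M}_{\alpha,\beta}(k,\sigma)$ be the set of pairs $(f,g)$ of functions $f,g:E\to\mathbb{A}$ such that $f-g$ is a flow of $G$ over $\mathbb{A}$ and $\alpha|\mathrm{supp}(f)|+\beta|\mathrm{supp}(g)|\equiv k\pmod\sigma$. Put $D=\omega^\alpha+\omega^\beta+(q-2)\omega^{\alpha+\beta}$. If $D\neq0$, then $$\sum_{k=0}^{\sigma-1}\omega^k|\mathcal{M}_{\alpha,\beta}(k,\sigma)| = (1-\omega^\alpha)^r(1-\omega^\beta)^rD^{|E|-r}\,R\!\left(M(G);\frac{qD}{(1-\omega^\alpha)(1-\omega^\beta)},\frac{(1-\omega^\alpha)(1-\omega^\beta)}{D}\right).$$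
   Context: Setting (the paper's hypothesis "$G$ is a totally-$\mathbb{P}$ matrix and $\mathbb{A}$ a $\mathbb{P}$-module of order $q$", read as the following cases): either (i) $G$ is the vertex–edge or cycle–edge matrix of a graph with edge set $E$, or a totally unimodular matrix, and $\mathbb{A}$ is an Abelian group of order $q$; or (ii) $G$ is a matrix over $\mathrm{GF}(p^s)$, $\mathbb{A}=\mathrm{GF}(p^s)^d$, $q=p^{sd}$. With $H$ a matrix orthogonally dual to $G$ (same columns, rows of $H$ orthogonal to rows of $G$, ranks summing to $|E|$; integer in case (i)), a flow of $G$ over $\mathbb{A}$ is $h:E\to\mathbb{A}$ with $Hh^T=0$ (equivalently an $\mathbb{A}$-combination of rows of $G$). $\mathrm{supp}(f)=\{e: f(e)\ne0\}$. $M(G)$ is the matroid on $E$ of linear dependence of the columns of $G$, rank function $\mathrm{rk}$, rank $r$; $R(M;\lambda,x)=\sum_{B\subseteq E}\lambda^{r-\mathrm{rk}(B)}x^{|B|-\mathrm{rk}(B)}$.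
   Formalization: In case (i), when flows are defined by Hh^T=0, the integer dual H must itself be a vertex–edge, cycle–edge or totally unimodular matrix (false for arbitrary integer H, e.g. G=(0), H=(2), A=Z/2); flows as A-combinations of rows of G are covered without restriction. *)

theory Defs
  imports
    "HOL-Analysis.Finite_Cartesian_Product"
    "HOL-Number_Theory.Cong"
    "HOL-Library.FuncSet"
    "Graph_Theory.Graph_Theory"
    "Jordan_Normal_Form.DL_Submatrix"
    "Jordan_Normal_Form.DL_Rank"
    "Jordan_Normal_Form.Determinant"
begin

text \<open>
  The columns of a matrix \<open>G\<close> are labelled by \<open>E = {..<dim_col G}\<close>; its rows may have any number,
  and either dimension may be \<open>0\<close>. Functions on \<open>E\<close> with values in an Abelian group are functions
  on \<open>nat\<close> of which only the values on \<open>E\<close> matter.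
\<close>

section \<open>The matroid of a matrix and the rank generating polynomial\<close>

definition mat_rank :: "'k::field mat \<Rightarrow> nat" where
  "mat_rank G = vec_space.rank (dim_row G) G"

text \<open>
  Independence is that of the family of columns indexed by \<open>B\<close>: hence the injectivity
  requirement, which makes equal columns with different labels dependent (parallel).
\<close>

definition indep_columns :: "'k::field mat \<Rightarrow> nat set \<Rightarrow> bool" where
  "indep_columns G B \<longleftrightarrow> B \<subseteq> {..<dim_col G} \<and> inj_on (col G) B \<and>
     \<not> module.lin_dep class_ring (module_vec TYPE('k) (dim_row G)) (col G ` B)"

definition matroid_rank :: "('e set \<Rightarrow> bool) \<Rightarrow> 'e set \<Rightarrow> nat" where
  "matroid_rank indep B = Max (card ` {I. I \<subseteq> B \<and> indep I})"

definition rank_gen_poly ::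
    "'e set \<Rightarrow> ('e set \<Rightarrow> bool) \<Rightarrow> 'c::comm_ring_1 \<Rightarrow> 'c \<Rightarrow> 'c" where
  "rank_gen_poly E indep l x =
     (\<Sum>B\<in>Pow E. l ^ (matroid_rank indep E - matroid_rank indep B) *
                 x ^ (card B - matroid_rank indep B))"

definition matroid_R :: "'k::field mat \<Rightarrow> complex \<Rightarrow> complex \<Rightarrow> complex" where
  "matroid_R G l x = rank_gen_poly {..<dim_col G} (indep_columns G) l x"

definition orth_dual :: "'k::field mat \<Rightarrow> 'k mat \<Rightarrow> bool" where
  "orth_dual G H \<longleftrightarrow> dim_col H = dim_col G \<and>
     H * transpose_mat G = 0\<^sub>m (dim_row H) (dim_row G) \<and>
     mat_rank G + mat_rank H = dim_col G"

section \<open>Integer matrices\<close>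

abbreviation rat_mat :: "int mat \<Rightarrow> rat mat" where
  "rat_mat \<equiv> map_mat rat_of_int"

definition totally_unimodular :: "int mat \<Rightarrow> bool" where
  "totally_unimodular G \<longleftrightarrow>
     (\<forall>I J. I \<subseteq> {..<dim_row G} \<longrightarrow> J \<subseteq> {..<dim_col G} \<longrightarrow> card I = card J \<longrightarrow>
        det (submatrix G I J) \<in> {-1, 0, 1})"

text \<open>
  A graph (loops and parallel edges allowed) is given by a \<^const>\<open>fin_digraph\<close>, that is, by
  the graph together with an arbitrary reference orientation of its edges. The column of a
  loop in the vertex-edge matrix is \<open>0\<close>.
\<close>

definition vertex_edge_matrix :: "int mat \<Rightarrow> bool" where
  "vertex_edge_matrix G \<longleftrightarrow> (\<exists>\<Gamma> :: (nat, nat) pre_digraph.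
     fin_digraph \<Gamma> \<and> verts \<Gamma> = {..<dim_row G} \<and> arcs \<Gamma> = {..<dim_col G} \<and>
     (\<forall>v<dim_row G. \<forall>e<dim_col G.
        G $$ (v, e) = of_bool (head \<Gamma> e = v) - of_bool (tail \<Gamma> e = v)))"

text \<open>
  The cycles of the underlying undirected graph are directed cycles in the digraph having each
  edge \<open>e\<close> in both directions: \<open>(e, True)\<close> traverses \<open>e\<close> along its reference orientation and
  \<open>(e, False)\<close> against it. Requiring distinct edges excludes walks that use one edge back and
  forth. Loops are cycles of length 1 and pairs of parallel edges are cycles of length 2.
\<close>

definition two_way :: "('v, 'e) pre_digraph \<Rightarrow> ('v, 'e \<times> bool) pre_digraph" where
  "two_way \<Gamma> = \<lparr> verts = verts \<Gamma>, arcs = arcs \<Gamma> \<times> UNIV,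
     tail = (\<lambda>(e, d). if d then tail \<Gamma> e else head \<Gamma> e),
     head = (\<lambda>(e, d). if d then head \<Gamma> e else tail \<Gamma> e) \<rparr>"

definition undirected_cycle :: "('v, 'e) pre_digraph \<Rightarrow> ('e \<times> bool) list \<Rightarrow> bool" where
  "undirected_cycle \<Gamma> c \<longleftrightarrow> pre_digraph.cycle (two_way \<Gamma>) c \<and> distinct (map fst c)"

text \<open>
  One row for each cycle (identified with its edge set), with an arbitrary choice of one of the
  two directions in which it can be traversed.
\<close>

definition cycle_edge_matrix :: "int mat \<Rightarrow> bool" where
  "cycle_edge_matrix G \<longleftrightarrow> (\<exists>\<Gamma> :: (nat, nat) pre_digraph.
     fin_digraph \<Gamma> \<and> arcs \<Gamma> = {..<dim_col G} \<and>
     (\<forall>i<dim_row G. \<exists>c. undirected_cycle \<Gamma> c \<and>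
        (\<forall>e<dim_col G.
           G $$ (i, e) = of_bool ((e, True) \<in> set c) - of_bool ((e, False) \<in> set c))) \<and>
     (\<forall>c. undirected_cycle \<Gamma> c \<longrightarrow>
        (\<exists>!i. i < dim_row G \<and> {e. e < dim_col G \<and> G $$ (i, e) \<noteq> 0} = fst ` set c)))"

definition graphic_or_unimodular :: "int mat \<Rightarrow> bool" where
  "graphic_or_unimodular G \<longleftrightarrow>
     vertex_edge_matrix G \<or> cycle_edge_matrix G \<or> totally_unimodular G"

section \<open>Flows\<close>

definition int_scale :: "int \<Rightarrow> 'a::ab_group_add \<Rightarrow> 'a" where
  "int_scale k x = (if 0 \<le> k then (\<Sum>_<nat k. x) else - (\<Sum>_<nat (- k). x))"

definition kernel_flow ::
    "('c \<Rightarrow> 'a \<Rightarrow> 'a::ab_group_add) \<Rightarrow> 'c mat \<Rightarrow> (nat \<Rightarrow> 'a) \<Rightarrow> bool" where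
  "kernel_flow act H h \<longleftrightarrow>
     (\<forall>i<dim_row H. (\<Sum>e<dim_col H. act (H $$ (i, e)) (h e)) = 0)"

definition row_flow ::
    "('c \<Rightarrow> 'a \<Rightarrow> 'a::ab_group_add) \<Rightarrow> 'c mat \<Rightarrow> (nat \<Rightarrow> 'a) \<Rightarrow> bool" where
  "row_flow act G h \<longleftrightarrow>
     (\<exists>a. \<forall>e<dim_col G. h e = (\<Sum>i<dim_row G. act (G $$ (i, e)) (a i)))"

text \<open>
  \<open>is_flow\<close> is the property of being a flow of \<open>G\<close> over the group, in either of the two usual
  descriptions: as the kernel of an orthogonal dual \<open>H\<close>, or as the group-combinations of the
  rows of \<open>G\<close>. For an integer matrix \<open>G\<close>, the dual \<open>H\<close> is taken from the same class of matrices: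
  for an arbitrary integer \<open>H\<close> the kernel may be too big. For example, if all entries of \<open>H\<close> are
  even, then every function with values in a group of order 2 is in the kernel.
\<close>

definition int_flow_notion :: "int mat \<Rightarrow> ((nat \<Rightarrow> 'a::ab_group_add) \<Rightarrow> bool) \<Rightarrow> bool" where
  "int_flow_notion G is_flow \<longleftrightarrow>
     (\<exists>H. graphic_or_unimodular H \<and> orth_dual (rat_mat G) (rat_mat H) \<and>
          is_flow = kernel_flow int_scale H) \<or>
     is_flow = row_flow int_scale G"

definition field_flow_notion ::
    "'k::field mat \<Rightarrow> ((nat \<Rightarrow> 'k ^ 'd) \<Rightarrow> bool) \<Rightarrow> bool" where
  "field_flow_notion G is_flow \<longleftrightarrow>
     (\<exists>H. orth_dual G H \<and> is_flow = kernel_flow vector_scalar_mult H) \<or>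
     is_flow = row_flow vector_scalar_mult G"

section \<open>The pairs of functions\<close>

definition supp_on :: "'e set \<Rightarrow> ('e \<Rightarrow> 'a::zero) \<Rightarrow> 'e set" where
  "supp_on E f = {e \<in> E. f e \<noteq> 0}"

text \<open>Extensional functions, so that there is exactly one for each function on \<open>E\<close>.\<close>

definition flow_pairs ::
    "nat set \<Rightarrow> ((nat \<Rightarrow> 'a::ab_group_add) \<Rightarrow> bool) \<Rightarrow> int \<Rightarrow> int \<Rightarrow> nat \<Rightarrow> nat
       \<Rightarrow> ((nat \<Rightarrow> 'a) \<times> (nat \<Rightarrow> 'a)) set" where
  "flow_pairs E is_flow \<alpha> \<beta> k \<sigma> =
     {(f, g). f \<in> E \<rightarrow>\<^sub>E UNIV \<and> g \<in> E \<rightarrow>\<^sub>E UNIV \<and> is_flow (\<lambda>e. f e - g e) \<and>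
        [\<alpha> * int (card (supp_on E f)) + \<beta> * int (card (supp_on E g)) = int k] (mod int \<sigma>)}"

definition primitive_root_of_unity :: "nat \<Rightarrow> complex \<Rightarrow> bool" where
  "primitive_root_of_unity \<sigma> \<omega> \<longleftrightarrow> \<omega> ^ \<sigma> = 1 \<and> (\<forall>j. 0 < j \<and> j < \<sigma> \<longrightarrow> \<omega> ^ j \<noteq> 1)"

end

theory Submission
  imports Defs
begin

text \<open>
  Writing \<open>f = g + h\<close> with a flow \<open>h\<close>, the sum factorises over the edges: an edge contributes
  \<open>D + (1 - \<omega>\<^sup>\<alpha>)(1 - \<omega>\<^sup>\<beta>)\<close> if \<open>h\<close> vanishes there and \<open>D\<close> otherwise. Expanding the product over the sets
  \<open>B\<close> of edges reduces the theorem to the fact that \<open>q\<close> to the power \<open>r - rk B\<close> flows vanish on \<open>B\<close>.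

  That fact holds when every independent set of columns has a left inverse with entries in the ring
  of coefficients: then flows can be prescribed freely on a basis and are determined by their values
  there. Over a field this is clear; a totally unimodular matrix has the adjugate of a minor
  \<open>\<plusminus>1\<close> as left inverse, and for the two matrices of a graph it is obtained from rational potentials
  and from cycles. The combinations of rows of \<open>G\<close> lie in the kernel of a dual \<open>H\<close>, and by the same
  property of \<open>H\<close> this kernel has no more elements, so both notions of flow agree.
\<close>

section \<open>Independent columns and nonsingular minors\<close>

text \<open>Coefficients are attached to labels instead of column vectors, so that later arguments
  deal with entries only. The injectivity clause is absorbed: equal columns \<open>j\<close> and
  \<open>k\<close> give the relation with coefficients 1 and -1.\<close>

lemma indep_columns_iff:
  fixes G :: "'k::field mat"
  shows "indep_columns G B \<longleftrightarrow> B \<subseteq> {..<dim_col G} \<and>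
    (\<forall>c. (\<forall>v<dim_row G. (\<Sum>j\<in>B. c j * G $$ (v, j)) = 0) \<longrightarrow> (\<forall>j\<in>B. c j = 0))"
proof (cases "B \<subseteq> {..<dim_col G}")
  case True
  interpret vec_space "TYPE('k)" "dim_row G" .
  have fin: "finite B" using True finite_subset by blast
  have carr: "col G ` B \<subseteq> carrier_vec (dim_row G)" by (auto simp: col_def)
  have entry: "col G j $ v = G $$ (v, j)" if "j \<in> B" "v < dim_row G" for j v
    using that True by auto
  show ?thesis
  proof (intro iffI conjI True allI impI ballI)
    fix c j
    assume ind: "indep_columns G B" and j: "j \<in> B"
      and rel: "\<forall>v<dim_row G. (\<Sum>j\<in>B. c j * G $$ (v, j)) = 0"
    have inj: "inj_on (col G) B" and li: "lin_indpt (col G ` B)"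
      using ind by (auto simp: indep_columns_def)
    define a where "a = c \<circ> inv_into B (col G)"
    have a: "a (col G i) = c i" if "i \<in> B" for i using inj that by (simp add: a_def)
    have lc: "lincomb a (col G ` B) = 0\<^sub>v (dim_row G)"
    proof (rule eq_vecI)
      fix v assume "v < dim_vec (0\<^sub>v (dim_row G) :: 'k vec)"
      hence v: "v < dim_row G" by simp
      have "lincomb a (col G ` B) $ v = (\<Sum>x\<in>col G ` B. a x * x $ v)"
        by (rule lincomb_index[OF v carr])
      also have "\<dots> = (\<Sum>j\<in>B. c j * G $$ (v, j))"
        using inj a entry v by (simp add: sum.reindex)
      finally show "lincomb a (col G ` B) $ v = 0\<^sub>v (dim_row G) $ v" using rel v by simp
    qed (use fin carr in \<open>simp add: lincomb_dim\<close>)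
    have "a \<in> col G ` B \<rightarrow> {\<zero>\<^bsub>class_ring\<^esub>}"
      using not_lindepD[OF li, of "col G ` B" a] fin lc by simp
    from Pi_mem[OF this imageI[OF j]] show "c j = 0" using a[OF j] by simp
  next
    assume R: "B \<subseteq> {..<dim_col G} \<and>
      (\<forall>c. (\<forall>v<dim_row G. (\<Sum>j\<in>B. c j * G $$ (v, j)) = 0) \<longrightarrow> (\<forall>j\<in>B. c j = 0))"
    hence rel: "c j = 0" if "\<And>v. v < dim_row G \<Longrightarrow> (\<Sum>j\<in>B. c j * G $$ (v, j)) = 0" "j \<in> B" for c j
      using that by blast
    have inj: "inj_on (col G) B"
    proof (rule inj_onI, rule ccontr)
      fix j k assume j: "j \<in> B" and k: "k \<in> B" and eq: "col G j = col G k" and ne: "j \<noteq> k"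
      define c where "c = (\<lambda>i. of_bool (i = j) - of_bool (i = k) :: 'k)"
      have "(\<Sum>i\<in>B. c i * G $$ (v, i)) = 0" if v: "v < dim_row G" for v
      proof -
        have "(\<Sum>i\<in>B. c i * G $$ (v, i)) = G $$ (v, j) - G $$ (v, k)"
          using fin j k by (simp add: c_def left_diff_distrib sum_subtractf sum.delta if_distrib)
        thus ?thesis using entry[OF j v] entry[OF k v] eq by simp
      qed
      from rel[OF this j] show False using ne by (simp add: c_def)
    qed
    have "lin_indpt (col G ` B)"
    proof
      assume "lin_dep (col G ` B)"
      with finite_lin_dep[of "col G ` B"] fin carr obtain a w
        where lc: "lincomb a (col G ` B) = 0\<^sub>v (dim_row G)" and w: "w \<in> col G ` B" "a w \<noteq> 0"
        by auto
      from w obtain j where j: "j \<in> B" "a (col G j) \<noteq> 0" by auto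
      have "(\<Sum>j\<in>B. a (col G j) * G $$ (v, j)) = 0" if v: "v < dim_row G" for v
      proof -
        have "lincomb a (col G ` B) $ v = (\<Sum>x\<in>col G ` B. a x * x $ v)"
          by (rule lincomb_index[OF v carr])
        also have "\<dots> = (\<Sum>j\<in>B. a (col G j) * G $$ (v, j))"
          using inj entry v by (simp add: sum.reindex)
        finally show ?thesis using lc v by simp
      qed
      from rel[OF this j(1)] j(2) show False by simp
    qed
    thus "indep_columns G B" using True inj by (simp add: indep_columns_def)
  qed
qed (simp add: indep_columns_def)

lemma finite_indep_columns: "indep_columns G I \<Longrightarrow> finite I"
  by (auto simp: indep_columns_def intro: finite_subset)

lemma indep_columns_subset:
  assumes "indep_columns G B" "A \<subseteq> B"
  shows "indep_columns G A"
proof -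
  interpret vec_space "TYPE('a)" "dim_row G" .
  have "col G ` A \<subseteq> col G ` B" using assms(2) by auto
  thus ?thesis using assms unfolding indep_columns_def
    by (meson inj_on_subset subset_li_is_li subset_trans)
qed

lemma bij_betw_pick:
  assumes "finite S"
  shows "bij_betw (pick S) {..<card S} S"
proof -
  have inj: "inj_on (pick S) {..<card S}"
    by (rule linorder_inj_onI) (auto dest: pick_mono_le)
  moreover have "pick S ` {..<card S} = S"
  proof (rule card_subset_eq[OF assms])
    show "pick S ` {..<card S} \<subseteq> S" by (auto intro: pick_in_set_le)
    show "card (pick S ` {..<card S}) = card S" using card_image[OF inj] by simp
  qed
  ultimately show ?thesis by (simp add: bij_betw_def)
qed

lemma submatrix_eq_mat:
  assumes "J \<subseteq> {..<dim_row G}" "I \<subseteq> {..<dim_col G}"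
  shows "submatrix G J I = mat (card J) (card I) (\<lambda>(a, b). G $$ (pick J a, pick I b))"
proof -
  have "{i. i < dim_row G \<and> i \<in> J} = J" "{i. i < dim_col G \<and> i \<in> I} = I" using assms by auto
  thus ?thesis by (simp add: submatrix_def)
qed

text \<open>One row is spent per column: when \<open>i\<close> is added, the rows in
  \<open>J\<close> leave at most a one-dimensional space of relations, and a single further row
  \<open>w\<close> removes it. Equality of the two cardinalities is obtained afterwards, from
  determinants.\<close>

lemma indep_columns_small_row_set:
  fixes G :: "'k::field mat"
  assumes "indep_columns G I"
  shows "\<exists>J\<subseteq>{..<dim_row G}. card J \<le> card I \<and>
    (\<forall>c. (\<forall>v\<in>J. (\<Sum>j\<in>I. c j * G $$ (v, j)) = 0) \<longrightarrow> (\<forall>i\<in>I. c i = 0))"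
  using finite_indep_columns[OF assms] assms
proof (induction I)
  case (insert i I)
  have ind: "indep_columns G I" using insert.prems by (rule indep_columns_subset) auto
  from insert.IH[OF ind] obtain J where J: "J \<subseteq> {..<dim_row G}" "card J \<le> card I"
    and rel: "\<And>c k. \<forall>v\<in>J. (\<Sum>j\<in>I. c j * G $$ (v, j)) = 0 \<Longrightarrow> k \<in> I \<Longrightarrow> c k = 0" by blast
  have finJ: "finite J" using J(1) finite_subset by blast
  show ?case
  proof (cases "\<forall>c. (\<forall>v\<in>J. (\<Sum>j\<in>insert i I. c j * G $$ (v, j)) = 0) \<longrightarrow> (\<forall>k\<in>insert i I. c k = 0)")
    case True
    thus ?thesis using J insert.hyps by (intro exI[of _ J]) auto
  next
    case False
    then obtain c k where c: "\<And>v. v \<in> J \<Longrightarrow> (\<Sum>j\<in>insert i I. c j * G $$ (v, j)) = 0"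
      and k: "k \<in> insert i I" "c k \<noteq> 0" by blast
    obtain w where w: "w < dim_row G" "(\<Sum>j\<in>insert i I. c j * G $$ (w, j)) \<noteq> 0"
      using insert.prems k unfolding indep_columns_iff by blast
    have ci: "c i \<noteq> 0"
    proof
      assume ci: "c i = 0"
      have "\<forall>v\<in>J. (\<Sum>j\<in>I. c j * G $$ (v, j)) = 0" using c ci insert.hyps by simp
      from rel[OF this] have "\<forall>j\<in>I. c j = 0" by blast
      thus False using k ci by auto
    qed
    have "d k = 0" if d: "\<forall>v\<in>insert w J. (\<Sum>j\<in>insert i I. d j * G $$ (v, j)) = 0"
      and k: "k \<in> insert i I" for d k
    proof -
      \<comment> \<open>Subtracting the multiple of \<open>c\<close> that cancels the coefficient at
        \<open>i\<close> leaves a relation on \<open>I\<close> alone, so \<open>d\<close> is this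
        multiple of \<open>c\<close>; the row \<open>w\<close> then forces the multiple to be
        0.\<close>
      define t where "t = d i / c i"
      have di: "d i = t * c i" using ci by (simp add: t_def)
      have sub: "(\<Sum>j\<in>I. (d j - t * c j) * G $$ (v, j)) =
          (\<Sum>j\<in>insert i I. d j * G $$ (v, j)) - t * (\<Sum>j\<in>insert i I. c j * G $$ (v, j))" for v
        using insert.hyps di
        by (simp add: algebra_simps sum_subtractf sum_distrib_left)
      have "\<forall>v\<in>J. (\<Sum>j\<in>I. (d j - t * c j) * G $$ (v, j)) = 0"
        unfolding sub using c d by simp
      from rel[OF this] have dj: "d j = t * c j" if "j \<in> I" for j using that by auto
      have "(\<Sum>j\<in>I. (d j - t * c j) * G $$ (w, j)) = 0" using dj by simp
      hence "t = 0" unfolding sub using w d by simp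
      thus ?thesis using dj di k by auto
    qed
    moreover have "card (insert w J) \<le> card (insert i I)"
      using J(2) finJ insert.hyps by (simp add: card_insert_if)
    ultimately show ?thesis using J(1) w(1) by (intro exI[of _ "insert w J"]) blast
  qed
qed auto

text \<open>
  If there were fewer rows than columns in \<open>J\<close>, padding with zero rows would give a singular square
  matrix, hence a relation between the columns.
\<close>

lemma indep_columns_nonsingular_minor:
  fixes G :: "'k::field mat"
  assumes "indep_columns G I"
  obtains J where "J \<subseteq> {..<dim_row G}" "card J = card I" "det (submatrix G J I) \<noteq> 0"
proof -
  obtain J where J: "J \<subseteq> {..<dim_row G}" "card J \<le> card I"
    and rel: "\<forall>c. (\<forall>v\<in>J. (\<Sum>j\<in>I. c j * G $$ (v, j)) = 0) \<longrightarrow> (\<forall>i\<in>I. c i = 0)"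
    using indep_columns_small_row_set[OF assms] by blast
  have I: "finite I" "I \<subseteq> {..<dim_col G}"
    using assms finite_subset by (auto simp: indep_columns_def)
  have finJ: "finite J" using J(1) finite_subset by blast
  note bI = bij_betw_pick[OF I(1)] and bJ = bij_betw_pick[OF finJ]
  define n where "n = card I"
  define M where "M = mat n n (\<lambda>(a, b). if a < card J then G $$ (pick J a, pick I b) else 0)"
  have M: "M \<in> carrier_mat n n" by (simp add: M_def)
  have det: "det M \<noteq> 0"
  proof
    assume "det M = 0"
    then obtain x where x: "x \<in> carrier_vec n" "x \<noteq> 0\<^sub>v n" "M *\<^sub>v x = 0\<^sub>v n"
      using det_0_iff_vec_prod_zero_field[OF M] by blast
    define c where "c i = x $ inv_into {..<n} (pick I) i" for i
    have c: "c (pick I b) = x $ b" if "b < n" for b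
      using bI that by (simp add: c_def n_def bij_betw_def)
    have "(\<Sum>j\<in>I. c j * G $$ (v, j)) = 0" if v: "v \<in> J" for v
    proof -
      obtain a where a: "a < card J" "v = pick J a" using v bJ by (auto simp: bij_betw_def)
      hence an: "a < n" using J(2) by (simp add: n_def)
      have "(\<Sum>j\<in>I. c j * G $$ (v, j)) = (\<Sum>b<n. x $ b * G $$ (v, pick I b))"
        using sum.reindex_bij_betw[OF bI, of "\<lambda>j. c j * G $$ (v, j)"] c by (simp add: n_def)
      also have "\<dots> = (M *\<^sub>v x) $ a"
        using a an x(1) by (simp add: M_def scalar_prod_def mult.commute atLeast0LessThan)
      finally show ?thesis using x(3) an by simp
    qed
    with rel have c0: "c i = 0" if "i \<in> I" for i using that by blast
    have "x $ b = 0" if "b < n" for b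
      using c[OF that] c0[OF pick_in_set_le[of b I]] that by (simp add: n_def)
    hence "x = 0\<^sub>v n" using x(1) by (intro eq_vecI) auto
    thus False using x(2) by simp
  qed
  have "card J = n"
  proof (rule ccontr)
    assume "card J \<noteq> n"
    hence lt: "card J < n" using J(2) by (simp add: n_def)
    have "M = mat\<^sub>r n n (\<lambda>i. if i = card J then 0\<^sub>v n else row M i)"
      by (rule eq_matI) (auto simp: M_def)
    moreover have "det \<dots> = 0" by (rule det_row_0[OF lt]) (auto simp: M_def)
    ultimately have "det M = 0" by simp
    thus False using det by simp
  qed
  moreover from this have "submatrix G J I = M"
    unfolding submatrix_eq_mat[OF J(1) I(2)] by (intro eq_matI) (auto simp: M_def n_def)
  ultimately show thesis using that J(1) det by (simp add: n_def)
qed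

text \<open>Cramer's rule without division: \<open>y\<close> is a row of the adjugate of the minor,
  placed on the rows in \<open>J\<close> and 0 elsewhere. Staying in a commutative ring lets it
  serve fields and integer matrices alike.\<close>

lemma submatrix_det_dual_row:
  fixes G :: "'c::comm_ring_1 mat"
  assumes J: "J \<subseteq> {..<dim_row G}" and I: "I \<subseteq> {..<dim_col G}" and card: "card J = card I"
    and i: "i \<in> I"
  obtains y where "\<And>j. j \<in> I \<Longrightarrow>
    (\<Sum>v<dim_row G. y v * G $$ (v, j)) = of_bool (j = i) * det (submatrix G J I)"
proof -
  define n where "n = card I"
  let ?M = "submatrix G J I"
  have fin: "finite J" "finite I" using I J finite_subset by blast+
  note bI = bij_betw_pick[OF fin(2)] and bJ = bij_betw_pick[OF fin(1)]
  have M: "?M \<in> carrier_mat n n" by (simp add: submatrix_eq_mat[OF J I] card n_def)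
  note adj = adj_mat[OF M]
  obtain a where a: "a < n" "i = pick I a" using i bI by (auto simp: bij_betw_def n_def)
  define y where "y v = (if v \<in> J then adj_mat ?M $$ (a, inv_into {..<n} (pick J) v) else 0)" for v
  have y: "y (pick J b) = adj_mat ?M $$ (a, b)" if "b < n" for b
    using that bJ card by (auto simp: y_def n_def bij_betw_def)
  have "(\<Sum>v<dim_row G. y v * G $$ (v, j)) = of_bool (j = i) * det ?M" if j: "j \<in> I" for j
  proof -
    obtain b where b: "b < n" "j = pick I b" using j bI by (auto simp: bij_betw_def n_def)
    have "(\<Sum>v<dim_row G. y v * G $$ (v, j)) = (\<Sum>v\<in>J. y v * G $$ (v, j))"
      using J by (intro sum.mono_neutral_right) (auto simp: y_def)
    also have "\<dots> = (\<Sum>k<n. adj_mat ?M $$ (a, k) * G $$ (pick J k, j))"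
      using sum.reindex_bij_betw[OF bJ, of "\<lambda>v. y v * G $$ (v, j)"] y card by (simp add: n_def)
    also have "\<dots> = (adj_mat ?M * ?M) $$ (a, b)"
      using a b adj(1) M card
      by (simp add: scalar_prod_def atLeast0LessThan submatrix_eq_mat[OF J I] n_def)
    also have "\<dots> = of_bool (a = b) * det ?M" using adj(3) a b by simp
    also have "a = b \<longleftrightarrow> j = i" using a b bI by (auto simp: n_def bij_betw_def inj_on_def)
    finally show ?thesis .
  qed
  thus thesis using that by blast
qed

section \<open>The rank function of the column matroid\<close>

lemma indep_columns_empty: "indep_columns G {}"
  by (simp add: indep_columns_iff)

lemma matroid_rank_witness:
  obtains I where "I \<subseteq> B" "indep_columns G I" "card I = matroid_rank (indep_columns G) B"
proof -
  let ?S = "{I. I \<subseteq> B \<and> indep_columns G I}"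
  have "finite ?S" by (rule finite_subset[of _ "Pow {..<dim_col G}"]) (auto simp: indep_columns_def)
  moreover have "?S \<noteq> {}" using indep_columns_empty by blast
  ultimately have "Max (card ` ?S) \<in> card ` ?S" by (intro Max_in) auto
  thus thesis using that by (auto simp: matroid_rank_def)
qed

lemma card_le_matroid_rank:
  assumes "I \<subseteq> B" "indep_columns G I"
  shows "card I \<le> matroid_rank (indep_columns G) B"
proof -
  let ?S = "{I. I \<subseteq> B \<and> indep_columns G I}"
  have "finite ?S" by (rule finite_subset[of _ "Pow {..<dim_col G}"]) (auto simp: indep_columns_def)
  thus ?thesis unfolding matroid_rank_def using assms by (intro Max_ge) auto
qed

text \<open>\<open>rank\<close> counts a maximal independent set of column vectors, the matroid rank
  counts labels. Choosing one label for each vector passes from the former to the latter, so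
  repeated columns do no harm.\<close>

lemma matroid_rank_eq_mat_rank:
  "matroid_rank (indep_columns G) {..<dim_col G} = mat_rank G"
proof (rule antisym)
  interpret vec_space "TYPE('a)" "dim_row G" .
  have G: "G \<in> carrier_mat (dim_row G) (dim_col G)" by simp
  obtain I where I: "I \<subseteq> {..<dim_col G}" "indep_columns G I"
    "card I = matroid_rank (indep_columns G) {..<dim_col G}" by (rule matroid_rank_witness)
  have "card (col G ` I) \<le> rank G"
    using I by (intro rank_ge_card_indpt[OF G]) (auto simp: indep_columns_def cols_def)
  thus "matroid_rank (indep_columns G) {..<dim_col G} \<le> mat_rank G"
    using I card_image[of "col G" I] by (simp add: indep_columns_def mat_rank_def)
  have "{} \<subseteq> set (cols G) \<and> lin_indpt {}"
    using indep_columns_empty[of G] by (simp add: indep_columns_def)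
  then obtain S where S: "maximal S (\<lambda>T. T \<subseteq> set (cols G) \<and> lin_indpt T)"
    using maximal_exists_superset[of "set (cols G)" "\<lambda>T. T \<subseteq> set (cols G) \<and> lin_indpt T" "{}"] by auto
  hence "S \<subseteq> set (cols G)" and li: "lin_indpt S"
    unfolding maximal_def by blast+
  hence "S \<subseteq> col G ` {..<dim_col G}" by (metis atLeast0LessThan cols_def list.set_map set_upt)
  then obtain I' where I': "I' \<subseteq> {..<dim_col G}" "inj_on (col G) I'" "S = col G ` I'"
    by (meson subset_image_inj)
  hence "indep_columns G I'" using li by (simp add: indep_columns_def)
  from card_le_matroid_rank[OF I'(1) this]
  show "mat_rank G \<le> matroid_rank (indep_columns G) {..<dim_col G}"
    using rank_card_indpt[OF G S] I' by (simp add: mat_rank_def card_image)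
qed

section \<open>Counting flows\<close>

text \<open>The functions \<open>y\<close> are the rows of a left inverse of the columns in
  \<open>I\<close>, with entries in the ring itself. Over the integers this is stronger than
  independence: the matrix with the single entry 2 has an independent column that is not
  split.\<close>

definition split_columns :: "'c::comm_ring_1 mat \<Rightarrow> nat set \<Rightarrow> bool" where
  "split_columns G I \<longleftrightarrow>
     (\<forall>i\<in>I. \<exists>y. \<forall>j\<in>I. (\<Sum>v<dim_row G. y v * G $$ (v, j)) = of_bool (j = i))"

text \<open>Independence is tested in the field, the left inverse is demanded in the ring. Integer
  matrices with \<open>rat_of_int\<close> and matrices over a field with the identity thus become
  instances of one notion; for integers it says that independent columns generate a direct
  summand.\<close>

definition regular_matrix :: "('c::comm_ring_1 \<Rightarrow> 'k::field) \<Rightarrow> 'c mat \<Rightarrow> bool" where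
  "regular_matrix \<phi> G \<longleftrightarrow> (\<forall>I. indep_columns (map_mat \<phi> G) I \<longrightarrow> split_columns G I)"

lemma split_columns_dual_rows:
  assumes "split_columns G I"
  shows "\<exists>y. \<forall>i\<in>I. \<forall>j\<in>I. (\<Sum>v<dim_row G. y i v * G $$ (v, j)) = of_bool (j = i)"
  using assms unfolding split_columns_def by (intro bchoice) blast

locale inj_hom_to_field = inj_comm_ring_hom hom
  for hom :: "'c::comm_ring_1 \<Rightarrow> 'k::field"

text \<open>A dependence over the field becomes one over the ring: multiplying it by the left
  inverse of the columns in \<open>I\<close> shows that the ratios of its coefficients to the one at
  \<open>e\<close> come from the ring. Injectivity of \<open>hom\<close> brings the relation
  back.\<close>

lemma (in inj_hom_to_field) regular_matrix_column_combination:
  fixes G :: "'c mat"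
  assumes reg: "regular_matrix hom G"
    and I: "indep_columns (map_mat hom G) I"
    and e: "e < dim_col G" "e \<notin> I" and dep: "\<not> indep_columns (map_mat hom G) (insert e I)"
  obtains n where "\<And>v. v < dim_row G \<Longrightarrow> G $$ (v, e) = (\<Sum>i\<in>I. n i * G $$ (v, i))"
proof -
  have IE: "finite I" "I \<subseteq> {..<dim_col G}"
    using finite_indep_columns[OF I] I by (auto simp: indep_columns_def)
  hence entry: "map_mat hom G $$ (v, j) = hom (G $$ (v, j))" if "v < dim_row G" "j \<in> insert e I" for v j
    using that e by auto
  obtain y where y: "\<And>i j. i \<in> I \<Longrightarrow> j \<in> I \<Longrightarrow>
      (\<Sum>v<dim_row G. y i v * G $$ (v, j)) = of_bool (j = i)"
    using reg I split_columns_dual_rows unfolding regular_matrix_def by blast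
  have "\<exists>c. (\<forall>v<dim_row G. (\<Sum>j\<in>insert e I. c j * map_mat hom G $$ (v, j)) = 0) \<and>
      (\<exists>j\<in>insert e I. c j \<noteq> 0)"
    using dep IE(2) e(1) unfolding indep_columns_iff by auto
  then obtain c where c: "\<And>v. v < dim_row G \<Longrightarrow> (\<Sum>j\<in>insert e I. c j * hom (G $$ (v, j))) = 0"
    and nz: "\<exists>j\<in>insert e I. c j \<noteq> 0" using entry by auto
  have ce: "c e \<noteq> 0"
  proof
    assume ce: "c e = 0"
    have "(\<Sum>j\<in>I. c j * map_mat hom G $$ (v, j)) = 0" if "v < dim_row (map_mat hom G)" for v
      using c[of v] that IE e(2) ce entry[of v] by simp
    hence "\<forall>j\<in>I. c j = 0" using I unfolding indep_columns_iff by blast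
    thus False using nz ce by auto
  qed
  \<comment> \<open>The left inverse applied to column \<open>e\<close> is the only candidate for
    the coefficients.\<close>
  define n where "n i = (\<Sum>v<dim_row G. y i v * G $$ (v, e))" for i
  have cn: "c i = - c e * hom (n i)" if i: "i \<in> I" for i
  proof -
    have "0 = (\<Sum>v<dim_row G. hom (y i v) * (\<Sum>j\<in>insert e I. c j * hom (G $$ (v, j))))"
      using c by simp
    also have "\<dots> = (\<Sum>j\<in>insert e I. c j * hom (\<Sum>v<dim_row G. y i v * G $$ (v, j)))"
      unfolding sum_distrib_left hom_distribs by (subst sum.swap) (simp add: mult_ac)
    also have "\<dots> = c e * hom (n i) + (\<Sum>j\<in>I. c j * hom (of_bool (j = i)))"
      using IE e(2) y[OF i] by (simp add: n_def)
    also have "(\<Sum>j\<in>I. c j * hom (of_bool (j = i))) = (\<Sum>j\<in>I. if j = i then c j else 0)"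
      by (intro sum.cong) auto
    also have "\<dots> = c i" using i IE by simp
    finally show ?thesis by (simp add: eq_neg_iff_add_eq_0 add.commute)
  qed
  have "G $$ (v, e) = (\<Sum>i\<in>I. n i * G $$ (v, i))" if v: "v < dim_row G" for v
  proof -
    have "0 = c e * hom (G $$ (v, e)) + (\<Sum>i\<in>I. c i * hom (G $$ (v, i)))"
      using c[OF v] IE e(2) by simp
    also have "(\<Sum>i\<in>I. c i * hom (G $$ (v, i))) = - c e * hom (\<Sum>i\<in>I. n i * G $$ (v, i))"
      unfolding hom_distribs sum_distrib_left by (intro sum.cong) (auto simp: cn)
    finally have "hom (G $$ (v, e)) = hom (\<Sum>i\<in>I. n i * G $$ (v, i))" using ce by simp
    thus ?thesis by simp
  qed
  thus thesis using that by blast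
qed

section \<open>Row flows and kernel flows over a module\<close>

lemma row_flow_cong:
  "(\<And>e. e < dim_col G \<Longrightarrow> h e = h' e) \<Longrightarrow> row_flow act G h = row_flow act G h'"
  by (simp add: row_flow_def)

lemma kernel_flow_cong:
  "(\<And>e. e < dim_col H \<Longrightarrow> h e = h' e) \<Longrightarrow> kernel_flow act H h = kernel_flow act H h'"
  by (simp add: kernel_flow_def)

context Modules.module
begin

lemma row_flow_column_combination:
  assumes h: "row_flow scale G h" and I: "I \<subseteq> {..<dim_col G}" and e: "e < dim_col G"
    and n: "\<And>v. v < dim_row G \<Longrightarrow> G $$ (v, e) = (\<Sum>i\<in>I. n i * G $$ (v, i))"
  shows "h e = (\<Sum>i\<in>I. scale (n i) (h i))"
proof -
  obtain a where a: "\<And>e. e < dim_col G \<Longrightarrow> h e = (\<Sum>v<dim_row G. scale (G $$ (v, e)) (a v))"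
    using h by (auto simp: row_flow_def)
  have "h e = (\<Sum>v<dim_row G. \<Sum>i\<in>I. scale (n i) (scale (G $$ (v, i)) (a v)))"
    using a[OF e] n by (simp add: scale_sum_left)
  also have "\<dots> = (\<Sum>i\<in>I. scale (n i) (\<Sum>v<dim_row G. scale (G $$ (v, i)) (a v)))"
    by (subst sum.swap) (simp add: scale_sum_right)
  also have "\<dots> = (\<Sum>i\<in>I. scale (n i) (h i))"
    using I a by (intro sum.cong) auto
  finally show ?thesis .
qed

text \<open>The prescribed values are multiplied by the rows of the left inverse to give the
  coefficients of the rows of \<open>G\<close>.\<close>

lemma row_flow_interpolation:
  assumes "split_columns G I" and I: "I \<subseteq> {..<dim_col G}"
  obtains h where "row_flow scale G h" "\<And>i. i \<in> I \<Longrightarrow> h i = x i"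
proof -
  obtain y where y: "\<And>i j. i \<in> I \<Longrightarrow> j \<in> I \<Longrightarrow>
      (\<Sum>v<dim_row G. y i v * G $$ (v, j)) = of_bool (j = i)"
    using split_columns_dual_rows[OF assms(1)] by blast
  have fin: "finite I" using I finite_subset by blast
  define h where "h e = (\<Sum>v<dim_row G. scale (G $$ (v, e)) (\<Sum>i\<in>I. scale (y i v) (x i)))" for e
  have "h j = x j" if j: "j \<in> I" for j
  proof -
    have "h j = (\<Sum>i\<in>I. scale (\<Sum>v<dim_row G. y i v * G $$ (v, j)) (x i))"
      unfolding h_def scale_sum_right scale_sum_left by (subst sum.swap) (simp add: mult.commute)
    also have "\<dots> = (\<Sum>i\<in>I. if i = j then x i else 0)"
      using y j by (intro sum.cong) auto
    finally show ?thesis using fin j by simp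
  qed
  moreover have "row_flow scale G h" by (auto simp: row_flow_def h_def)
  ultimately show thesis using that by blast
qed

text \<open>The difference of the two flows is supported on \<open>I\<close>, and the left inverse
  of the columns in \<open>I\<close> reads off each of its values from a vector that is 0.\<close>

lemma kernel_flow_eq_off_split_columns:
  assumes "kernel_flow scale H h" "kernel_flow scale H h'"
    and "split_columns H I" and I: "I \<subseteq> {..<dim_col H}"
    and off: "\<And>e. e \<in> {..<dim_col H} - I \<Longrightarrow> h e = h' e" and i: "i \<in> I"
  shows "h i = h' i"
proof -
  obtain y where y: "\<And>i j. i \<in> I \<Longrightarrow> j \<in> I \<Longrightarrow>
      (\<Sum>v<dim_row H. y i v * H $$ (v, j)) = of_bool (j = i)"
    using split_columns_dual_rows[OF assms(3)] by blast
  have fin: "finite I" using I finite_subset by blast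
  define d where "d e = h e - h' e" for e
  have ker: "(\<Sum>e<dim_col H. scale (H $$ (v, e)) (d e)) = 0" if "v < dim_row H" for v
    using that assms(1,2) by (simp add: d_def scale_right_diff_distrib sum_subtractf kernel_flow_def)
  have "0 = (\<Sum>v<dim_row H. scale (y i v) (\<Sum>e<dim_col H. scale (H $$ (v, e)) (d e)))"
    using ker by simp
  also have "\<dots> = (\<Sum>e<dim_col H. scale (\<Sum>v<dim_row H. y i v * H $$ (v, e)) (d e))"
    unfolding scale_sum_right scale_sum_left by (subst sum.swap) simp
  also have "\<dots> = (\<Sum>e\<in>I. scale (\<Sum>v<dim_row H. y i v * H $$ (v, e)) (d e))"
    using I off by (intro sum.mono_neutral_right) (auto simp: d_def)
  also have "\<dots> = (\<Sum>e\<in>I. if e = i then d e else 0)"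
    using y i by (intro sum.cong) auto
  also have "\<dots> = d i" using fin i by simp
  finally show ?thesis by (simp add: d_def)
qed

lemma row_flow_imp_kernel_flow:
  assumes h: "row_flow scale G h" and dim: "dim_col H = dim_col G"
    and orth: "H * transpose_mat G = 0\<^sub>m (dim_row H) (dim_row G)"
  shows "kernel_flow scale H h"
proof -
  obtain a where a: "\<And>e. e < dim_col G \<Longrightarrow> h e = (\<Sum>u<dim_row G. scale (G $$ (u, e)) (a u))"
    using h by (auto simp: row_flow_def)
  have "(\<Sum>e<dim_col H. scale (H $$ (v, e)) (h e)) = 0" if v: "v < dim_row H" for v
  proof -
    have z: "(\<Sum>e<dim_col G. H $$ (v, e) * G $$ (u, e)) = 0" if u: "u < dim_row G" for u
    proof -
      have "(H * transpose_mat G) $$ (v, u) = (\<Sum>e<dim_col G. H $$ (v, e) * G $$ (u, e))"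
        using u v dim by (simp add: scalar_prod_def atLeast0LessThan)
      thus ?thesis using u v orth by simp
    qed
    have "(\<Sum>e<dim_col H. scale (H $$ (v, e)) (h e)) =
        (\<Sum>e<dim_col G. \<Sum>u<dim_row G. scale (H $$ (v, e) * G $$ (u, e)) (a u))"
      using a dim by (simp add: scale_sum_right)
    also have "\<dots> = (\<Sum>u<dim_row G. scale (\<Sum>e<dim_col G. H $$ (v, e) * G $$ (u, e)) (a u))"
      by (subst sum.swap) (simp add: scale_sum_left)
    also have "\<dots> = 0" using z by simp
    finally show ?thesis .
  qed
  thus ?thesis by (simp add: kernel_flow_def)
qed

end

text \<open>An upper bound is enough here, since the row flows of an orthogonal dual supply that
  many elements of the kernel.\<close>

lemma card_kernel_flows_le:
  fixes act :: "'c::comm_ring_1 \<Rightarrow> 'a::{ab_group_add, finite} \<Rightarrow> 'a"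
  assumes "Modules.module act" "split_columns H I" "I \<subseteq> {..<dim_col H}"
  shows "card {h \<in> {..<dim_col H} \<rightarrow>\<^sub>E UNIV. kernel_flow act H h} \<le> CARD('a) ^ (dim_col H - card I)"
proof -
  interpret Modules.module act by fact
  let ?E = "{..<dim_col H}"
  let ?K = "{h \<in> ?E \<rightarrow>\<^sub>E UNIV. kernel_flow act H h}"
  have "inj_on (\<lambda>h. restrict h (?E - I)) ?K"
  proof (rule inj_onI)
    fix h h' assume h: "h \<in> ?K" and h': "h' \<in> ?K"
      and eq: "restrict h (?E - I) = restrict h' (?E - I)"
    have off: "h e = h' e" if "e \<in> ?E - I" for e using fun_cong[OF eq, of e] that by simp
    have "h e = h' e" if "e \<in> ?E" for e
      using kernel_flow_eq_off_split_columns[of H h h' I e] off h h' assms(2,3) that by blast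
    thus "h = h'" using h h' by (intro PiE_ext[of h ?E "\<lambda>_. UNIV" h']) auto
  qed
  moreover have "(\<lambda>h. restrict h (?E - I)) ` ?K \<subseteq> (?E - I) \<rightarrow>\<^sub>E (UNIV :: 'a set)"
    by (rule image_subsetI) simp
  moreover have "finite ((?E - I) \<rightarrow>\<^sub>E (UNIV :: 'a set))" by (intro finite_PiE) auto
  ultimately have "card ?K \<le> card ((?E - I) \<rightarrow>\<^sub>E (UNIV :: 'a set))"
    by (rule card_inj_on_le)
  also have "\<dots> = CARD('a) ^ (dim_col H - card I)"
    using assms(3) by (simp add: card_funcsetE card_Diff_subset finite_subset)
  finally show ?thesis .
qed

text \<open>A flow takes arbitrary values on the basis \<open>I\<close> and is determined by them;
  as \<open>I \<inter> B\<close> spans \<open>B\<close>, it vanishes on \<open>B\<close> as soon as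
  it vanishes on \<open>I \<inter> B\<close>. So the values on \<open>I - B\<close> remain free.
  Bases are described by maximality under inclusion, so that different ones can be compared
  later.\<close>

lemma (in inj_hom_to_field) card_row_flows_vanishing_basis:
  fixes G :: "'c mat" and act :: "'c \<Rightarrow> 'm::{ab_group_add, finite} \<Rightarrow> 'm"
  assumes mod: "Modules.module act" and reg: "regular_matrix hom G"
    and B: "B \<subseteq> {..<dim_col G}" and I: "indep_columns (map_mat hom G) I"
    and max: "\<And>e. e < dim_col G \<Longrightarrow> e \<notin> I \<Longrightarrow> \<not> indep_columns (map_mat hom G) (insert e I)"
    and maxB: "\<And>e. e \<in> B \<Longrightarrow> e \<notin> I \<Longrightarrow> \<not> indep_columns (map_mat hom G) (insert e (I \<inter> B))"
  shows "card {h \<in> {..<dim_col G} \<rightarrow>\<^sub>E UNIV. row_flow act G h \<and> (\<forall>e\<in>B. h e = 0)} =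
    CARD('m) ^ card (I - B)"
proof -
  interpret M: Modules.module act by fact
  let ?E = "{..<dim_col G}"
  let ?F = "{h \<in> ?E \<rightarrow>\<^sub>E UNIV. row_flow act G h \<and> (\<forall>e\<in>B. h e = 0)}"
  have IE: "finite I" "I \<subseteq> ?E"
    using finite_indep_columns[OF I] I by (auto simp: indep_columns_def)
  have IB: "indep_columns (map_mat hom G) (I \<inter> B)" using I by (rule indep_columns_subset) auto
  have det: "h e = h' e" if h: "row_flow act G h" "row_flow act G h'"
    and eq: "\<And>i. i \<in> I \<Longrightarrow> h i = h' i" and e: "e < dim_col G" for h h' e
  proof (cases "e \<in> I")
    case False
    obtain n where n: "\<And>v. v < dim_row G \<Longrightarrow> G $$ (v, e) = (\<Sum>i\<in>I. n i * G $$ (v, i))"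
      using regular_matrix_column_combination[OF reg I e False max[OF e False]] by blast
    show ?thesis
      using M.row_flow_column_combination[OF h(1) IE(2) e n]
        M.row_flow_column_combination[OF h(2) IE(2) e n] eq by simp
  qed (use eq in auto)
  have van: "h e = 0" if h: "row_flow act G h"
    and z: "\<And>i. i \<in> I \<inter> B \<Longrightarrow> h i = 0" and e: "e \<in> B" for h e
  proof (cases "e \<in> I")
    case False
    have e': "e < dim_col G" using e B by auto
    obtain n where n: "\<And>v. v < dim_row G \<Longrightarrow> G $$ (v, e) = (\<Sum>i\<in>I \<inter> B. n i * G $$ (v, i))"
      using regular_matrix_column_combination[OF reg IB e' _ maxB[OF e False]] False by blast
    show ?thesis using M.row_flow_column_combination[OF h _ e' n] IE(2) z by auto
  qed (use z e in auto)
  have "bij_betw (\<lambda>h. restrict h (I - B)) ?F ((I - B) \<rightarrow>\<^sub>E UNIV)"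
  proof (rule bij_betw_imageI)
    show "inj_on (\<lambda>h. restrict h (I - B)) ?F"
    proof (rule inj_onI)
      fix h h' assume h: "h \<in> ?F" and h': "h' \<in> ?F"
        and eq: "restrict h (I - B) = restrict h' (I - B)"
      have "h i = h' i" if "i \<in> I" for i
        using fun_cong[OF eq, of i] that h h' by (cases "i \<in> B") auto
      hence "h e = h' e" if "e \<in> ?E" for e using det[of h h' e] h h' that by blast
      thus "h = h'" using h h' by (intro PiE_ext[of h ?E "\<lambda>_. UNIV" h']) auto
    qed
    show "(\<lambda>h. restrict h (I - B)) ` ?F = (I - B) \<rightarrow>\<^sub>E UNIV"
    proof (intro equalityI subsetI)
      fix x :: "nat \<Rightarrow> 'm" assume x: "x \<in> (I - B) \<rightarrow>\<^sub>E UNIV"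
      have "split_columns G I" using reg I by (simp add: regular_matrix_def)
      from M.row_flow_interpolation[OF this IE(2), of "\<lambda>i. if i \<in> B then 0 else x i"]
      obtain h where h: "row_flow act G h" "\<And>i. i \<in> I \<Longrightarrow> h i = (if i \<in> B then 0 else x i)"
        by blast
      have "h e = 0" if "e \<in> B" for e using van[OF h(1) _ that] h(2) by simp
      hence "restrict h ?E \<in> ?F"
        using h(1) B row_flow_cong[of G "restrict h ?E" h act] by auto
      moreover have "x = restrict (restrict h ?E) (I - B)"
        using x h(2) IE(2) by (intro ext) (auto simp: PiE_def extensional_def)
      ultimately show "x \<in> (\<lambda>h. restrict h (I - B)) ` ?F" by blast
    qed auto
  qed
  from bij_betw_same_card[OF this] show ?thesis using IE(1) by (simp add: card_funcsetE)
qed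

text \<open>
  The total number of flows is computed with a basis extending one of \<open>B\<close> and with one of maximal
  cardinality; comparing the two results replaces the basis exchange property.
\<close>

lemma (in inj_hom_to_field) card_row_flows_vanishing:
  fixes G :: "'c mat" and act :: "'c \<Rightarrow> 'm::{ab_group_add, finite} \<Rightarrow> 'm"
  assumes mod: "Modules.module act" and reg: "regular_matrix hom G"
    and B: "B \<subseteq> {..<dim_col G}"
  shows "card {h \<in> {..<dim_col G} \<rightarrow>\<^sub>E UNIV. row_flow act G h \<and> (\<forall>e\<in>B. h e = 0)} =
    CARD('m) ^ (mat_rank (map_mat hom G) - matroid_rank (indep_columns (map_mat hom G)) B)"
proof -
  let ?ind = "indep_columns (map_mat hom G)" and ?E = "{..<dim_col G}"
  let ?rk = "matroid_rank ?ind"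
  have rkE: "?rk ?E = mat_rank (map_mat hom G)"
    using matroid_rank_eq_mat_rank[of "map_mat hom G"] by simp
  have indE: "I \<subseteq> ?E" "finite I" if "?ind I" for I
    using finite_indep_columns[OF that] that by (auto simp: indep_columns_def)
  have ins: "\<not> ?ind (insert e I)" if "I \<subseteq> C" "card I = ?rk C" "e \<in> C" "e \<notin> I" "?ind I" for e I C
    using card_le_matroid_rank[of "insert e I" C "map_mat hom G"] that indE by auto
  obtain IB where IB: "IB \<subseteq> B" "?ind IB" "card IB = ?rk B" by (rule matroid_rank_witness)
  have "finite {I. ?ind I}" by (rule finite_subset[of _ "Pow ?E"]) (use indE in auto)
  from finite_has_maximal2[OF this, of IB] IB(2)
  obtain I where I: "?ind I" "IB \<subseteq> I" and maxI: "\<And>A. ?ind A \<Longrightarrow> I \<subseteq> A \<Longrightarrow> I = A" by auto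
  have max: "\<not> ?ind (insert e I)" if "e \<notin> I" for e using maxI[of "insert e I"] that by auto
  \<comment> \<open>\<open>IB\<close> already has the largest possible size within \<open>B\<close>,
    so extending it gains no element of \<open>B\<close>.\<close>
  have IBeq: "I \<inter> B = IB"
  proof (rule ccontr)
    assume "I \<inter> B \<noteq> IB"
    then obtain e where "e \<in> I" "e \<in> B" "e \<notin> IB" using I IB by blast
    moreover from this have "?ind (insert e IB)"
      using I by (intro indep_columns_subset[OF I(1)]) auto
    ultimately show False using ins[of IB B e] IB by blast
  qed
  let ?F = "\<lambda>C. {h \<in> ?E \<rightarrow>\<^sub>E UNIV. row_flow act G h \<and> (\<forall>e\<in>C. h e = 0)}"
  obtain I0 where I0: "I0 \<subseteq> ?E" "?ind I0" "card I0 = ?rk ?E" by (rule matroid_rank_witness)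
  have 1: "card (?F {}) = CARD('m) ^ card (I - {})"
    by (rule card_row_flows_vanishing_basis[OF mod reg _ I(1)]) (use max in auto)
  have 2: "card (?F {}) = CARD('m) ^ card (I0 - {})"
    by (rule card_row_flows_vanishing_basis[OF mod reg _ I0(2)]) (use I0 ins[of I0 ?E] in auto)
  have 3: "card (?F B) = CARD('m) ^ card (I - B)"
    by (rule card_row_flows_vanishing_basis[OF mod reg B I(1)])
      (use max IB ins[of IB B] IBeq in auto)
  have "card I = card (I - B) + ?rk B"
    using card_Int_Diff[OF indE(2)[OF I(1)], of B] IBeq IB by simp
  moreover have "?rk B \<le> ?rk ?E" using card_le_matroid_rank[of IB ?E "map_mat hom G"] IB B by auto
  \<comment> \<open>Powers are compared instead of exponents: in the trivial group equal powers do
    not give equal exponents. The common factor is positive and cancels.\<close>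
  ultimately have "CARD('m) ^ card (I - B) * CARD('m) ^ ?rk B =
      CARD('m) ^ (?rk ?E - ?rk B) * CARD('m) ^ ?rk B"
    using 1 2 I0(3) by (simp flip: power_add)
  thus ?thesis using 3 by (simp add: rkE)
qed

text \<open>Orthogonality gives one inclusion. The kernel has at most \<open>q\<close> to the power
  |E| - rk H = rk G elements, which is the exact number of row flows, and finiteness turns the
  inclusion into equality.\<close>

lemma (in inj_hom_to_field) kernel_flow_eq_row_flow:
  fixes G :: "'c mat" and act :: "'c \<Rightarrow> 'm::{ab_group_add, finite} \<Rightarrow> 'm"
  assumes mod: "Modules.module act" and regG: "regular_matrix hom G"
    and regH: "regular_matrix hom H" and dual: "orth_dual (map_mat hom G) (map_mat hom H)"
  shows "kernel_flow act H = row_flow act G"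
proof
  fix h :: "nat \<Rightarrow> 'm"
  interpret M: Modules.module act by fact
  let ?E = "{..<dim_col G}"
  let ?K = "{h \<in> ?E \<rightarrow>\<^sub>E UNIV. kernel_flow act H h}" and ?R = "{h \<in> ?E \<rightarrow>\<^sub>E UNIV. row_flow act G h}"
  have dim: "dim_col H = dim_col G" using dual by (simp add: orth_dual_def)
  \<comment> \<open>Orthogonality is given over the field; injectivity of \<open>hom\<close>
    transfers it to the ring, where the module scalars live.\<close>
  have "map_mat hom (H * transpose_mat G) = map_mat hom H * map_mat hom (transpose_mat G)"
    by (rule mat_hom_mult[of _ "dim_row H" "dim_col G" _ "dim_row G"]) (auto simp: dim)
  also have "map_mat hom (transpose_mat G) = transpose_mat (map_mat hom G)"
    by (rule eq_matI) auto
  also have "map_mat hom H * \<dots> = map_mat hom (0\<^sub>m (dim_row H) (dim_row G))"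
    using dual by (auto simp: orth_dual_def)
  finally have orth: "H * transpose_mat G = 0\<^sub>m (dim_row H) (dim_row G)"
    by (rule mat_hom_inj)
  have sub: "?R \<subseteq> ?K" using M.row_flow_imp_kernel_flow[OF _ dim orth] by auto
  obtain I where I: "I \<subseteq> ?E" "indep_columns (map_mat hom H) I"
    "card I = matroid_rank (indep_columns (map_mat hom H)) ?E" by (rule matroid_rank_witness)
  have "card I = mat_rank (map_mat hom H)"
    using I(3) matroid_rank_eq_mat_rank[of "map_mat hom H"] dim by simp
  moreover have "mat_rank (map_mat hom G) + mat_rank (map_mat hom H) = dim_col G"
    using dual by (simp add: orth_dual_def)
  ultimately have rk: "dim_col G - card I = mat_rank (map_mat hom G)" using dim by linarith
  have "split_columns H I" using regH I by (simp add: regular_matrix_def)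
  hence "card ?K \<le> CARD('m) ^ mat_rank (map_mat hom G)"
    using card_kernel_flows_le[OF mod, of H I] I(1) unfolding dim rk by blast
  also have "\<dots> = card ?R"
  proof -
    obtain I where "I \<subseteq> {}" "indep_columns (map_mat hom G) I" "card I = matroid_rank (indep_columns (map_mat hom G)) {}"
      by (rule matroid_rank_witness[of "{}" "map_mat hom G"])
    hence "matroid_rank (indep_columns (map_mat hom G)) {} = 0" by simp
    thus ?thesis using card_row_flows_vanishing[OF mod regG, of "{}"] by simp
  qed
  finally have le: "card ?K \<le> card ?R" .
  have "finite ?K"
    by (rule finite_subset[of _ "?E \<rightarrow>\<^sub>E UNIV"]) (auto intro!: finite_PiE)
  hence "?R = ?K" using sub le by (rule card_seteq)
  \<comment> \<open>The count concerns extensional functions, the claim all functions on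
    \<open>nat\<close>; both kinds of flow depend only on the values on \<open>?E\<close>.\<close>
  hence "restrict h ?E \<in> ?K \<longleftrightarrow> restrict h ?E \<in> ?R" by simp
  hence "kernel_flow act H (restrict h ?E) = row_flow act G (restrict h ?E)" by simp
  thus "kernel_flow act H h = row_flow act G h"
    using kernel_flow_cong[of H "restrict h ?E" h act] row_flow_cong[of G "restrict h ?E" h act] dim
    by simp
qed

section \<open>The generating function of pairs\<close>

text \<open>The contribution of one edge on which \<open>f - g\<close> has the value
  \<open>x\<close> and \<open>g\<close> the value \<open>y\<close>. For \<open>x = 0\<close> both
  functions vanish together; otherwise \<open>y = 0\<close> and \<open>y = -x\<close> are distinct
  and contribute \<open>a\<close> and \<open>b\<close>, every other \<open>y\<close> contributes
  \<open>a * b\<close>. The difference with 2 is formed in the complex numbers, so the trivial group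
  is covered.\<close>

lemma sum_pair_weights:
  fixes a b :: complex and x :: "'a::{ab_group_add, finite}"
  shows "(\<Sum>y\<in>UNIV. (if x + y \<noteq> 0 then a else 1) * (if y \<noteq> 0 then b else 1)) =
    (if x = 0 then (1 - a) * (1 - b) else 0) + (a + b + (of_nat CARD('a) - 2) * (a * b))"
proof (cases "x = 0")
  case True
  have "(\<Sum>y\<in>UNIV. (if x + y \<noteq> 0 then a else 1) * (if y \<noteq> 0 then b else 1)) =
      1 + (\<Sum>y\<in>UNIV - {0::'a}. a * b)"
    using True by (subst sum.remove[of _ 0]) (auto intro!: sum.cong)
  also have "\<dots> = 1 + (of_nat CARD('a) - 1) * (a * b)"
    by (simp add: card_Diff_singleton of_nat_diff)
  finally show ?thesis using True by (simp add: algebra_simps)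
next
  case False
  have "(\<Sum>y\<in>UNIV. (if x + y \<noteq> 0 then a else 1) * (if y \<noteq> 0 then b else 1)) =
      (\<Sum>y\<in>{0, -x}. (if x + y \<noteq> 0 then a else 1) * (if y \<noteq> 0 then b else 1)) +
      (\<Sum>y\<in>UNIV - {0, -x}. (if x + y \<noteq> 0 then a else 1) * (if y \<noteq> 0 then b else 1))"
    by (subst sum.subset_diff[of "{0, -x}"]) (simp_all only: subset_UNIV finite add.commute)
  also have "(\<Sum>y\<in>{0, -x}. (if x + y \<noteq> 0 then a else 1) * (if y \<noteq> 0 then b else 1)) = a + b"
    using False by simp
  also have "(\<Sum>y\<in>UNIV - {0, -x}. (if x + y \<noteq> 0 then a else 1) * (if y \<noteq> 0 then b else 1)) =
      (\<Sum>y\<in>UNIV - {0, -x}. a * b)"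
    by (intro sum.cong) (auto simp: add_eq_0_iff)
  also have "\<dots> = (of_nat CARD('a) - 2) * (a * b)"
  proof -
    have "card {0, -x} = 2" using False by simp
    moreover from this have "2 \<le> CARD('a)" using card_mono[of UNIV "{0, -x}"] by simp
    ultimately show ?thesis using False by (simp add: card_Diff_subset of_nat_diff)
  qed
  finally show ?thesis using False by simp
qed

text \<open>Since \<open>\<omega> ^ \<sigma> = 1\<close>, the factor \<open>\<omega> ^ k\<close> of
  a pair in class \<open>k\<close> equals \<open>\<omega>\<close> raised to its full weighted
  support size. The classes merge into one sum over all pairs, whose terms are products over the
  edges.\<close>

lemma sum_flow_pairs:
  fixes \<omega> :: complex and F :: "(nat \<Rightarrow> 'a::{ab_group_add, finite}) \<Rightarrow> bool"
  assumes "\<sigma> > 1" and \<omega>: "primitive_root_of_unity \<sigma> \<omega>" and E: "finite E"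
  defines "P \<equiv> {(f, g). f \<in> E \<rightarrow>\<^sub>E UNIV \<and> g \<in> E \<rightarrow>\<^sub>E UNIV \<and> F (\<lambda>e. f e - g e)}"
  shows "(\<Sum>k<\<sigma>. \<omega> ^ k * of_nat (card (flow_pairs E F \<alpha> \<beta> k \<sigma>))) =
    (\<Sum>(f, g)\<in>P. (\<Prod>e\<in>E. (if f e \<noteq> 0 then \<omega> powi \<alpha> else 1) * (if g e \<noteq> 0 then \<omega> powi \<beta> else 1)))"
proof -
  have \<omega>\<sigma>: "\<omega> ^ \<sigma> = 1" using \<omega> by (simp add: primitive_root_of_unity_def)
  hence \<omega>0: "\<omega> \<noteq> 0" using assms(1) by (auto simp: power_0_left)
  have finP: "finite P"
    by (rule finite_subset[of _ "(E \<rightarrow>\<^sub>E UNIV) \<times> (E \<rightarrow>\<^sub>E UNIV)"]) (auto simp: P_def E intro!: finite_PiE)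
  define N where "N = (\<lambda>(f :: nat \<Rightarrow> 'a, g :: nat \<Rightarrow> 'a). \<alpha> * int (card (supp_on E f)) + \<beta> * int (card (supp_on E g)))"
  \<comment> \<open>The residue in \<open>{..<\<sigma>}\<close> names the one class that contains
    the pair; the weight itself may be negative.\<close>
  define \<kappa> where "\<kappa> p = nat (N p mod int \<sigma>)" for p
  have pairs: "flow_pairs E F \<alpha> \<beta> k \<sigma> = {p \<in> P. \<kappa> p = k}" if "k < \<sigma>" for k
    using that assms(1) unfolding flow_pairs_def P_def \<kappa>_def N_def cong_def
    by (auto simp: nat_eq_iff2 zmod_int[symmetric])
  have pow: "\<omega> ^ \<kappa> p = \<omega> powi N p" for p
  proof -
    have "\<omega> powi N p = \<omega> powi (int \<sigma> * (N p div int \<sigma>) + N p mod int \<sigma>)" by simp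
    also have "\<dots> = (\<omega> powi int \<sigma>) powi (N p div int \<sigma>) * \<omega> powi (N p mod int \<sigma>)"
      using \<omega>0 by (simp only: power_int_add power_int_mult simp_thms)
    also have "\<dots> = \<omega> powi int (\<kappa> p)" using \<omega>\<sigma> assms(1) by (simp add: \<kappa>_def)
    finally show ?thesis by simp
  qed
  have supp: "(\<Prod>e\<in>E. if f e \<noteq> 0 then c else 1) = c ^ card (supp_on E f)"
    for f :: "nat \<Rightarrow> 'a" and c :: complex
    using E by (simp add: prod.If_cases supp_on_def Int_def)
  have "(\<Sum>k<\<sigma>. \<omega> ^ k * of_nat (card (flow_pairs E F \<alpha> \<beta> k \<sigma>))) =
      (\<Sum>k<\<sigma>. \<Sum>p\<in>{p \<in> P. \<kappa> p = k}. \<omega> ^ \<kappa> p)"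
    using pairs by (intro sum.cong) (auto simp: mult.commute)
  also have "\<dots> = (\<Sum>p\<in>P. \<omega> ^ \<kappa> p)"
    using assms(1) by (intro sum.group finP) (auto simp: \<kappa>_def nat_less_iff)
  also have "\<dots> = (\<Sum>(f, g)\<in>P. (\<Prod>e\<in>E. (if f e \<noteq> 0 then \<omega> powi \<alpha> else 1) * (if g e \<noteq> 0 then \<omega> powi \<beta> else 1)))"
  proof (intro sum.cong refl, clarify)
    fix f g
    show "\<omega> ^ \<kappa> (f, g) = (\<Prod>e\<in>E. (if f e \<noteq> 0 then \<omega> powi \<alpha> else 1) * (if g e \<noteq> 0 then \<omega> powi \<beta> else 1))"
      unfolding pow prod.distrib supp using \<omega>0 by (simp add: N_def power_int_add power_int_mult)
  qed
  finally show ?thesis .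
qed

text \<open>The substitution \<open>h = f - g\<close> leaves \<open>g\<close> unrestricted, so the
  sum over \<open>g\<close> becomes a product of edge sums. Expanding it, \<open>B\<close> is the
  set of edges where the summand \<open>c\<close> is chosen, which gives 0 unless \<open>h\<close>
  vanishes on \<open>B\<close>.\<close>

lemma sum_pairs_eq_sum_flows:
  fixes a b :: complex and F :: "(nat \<Rightarrow> 'a::{ab_group_add, finite}) \<Rightarrow> bool"
  assumes E: "finite E" and F: "\<And>h h'. (\<And>e. e \<in> E \<Longrightarrow> h e = h' e) \<Longrightarrow> F h = F h'"
  defines "P \<equiv> {(f, g). f \<in> E \<rightarrow>\<^sub>E UNIV \<and> g \<in> E \<rightarrow>\<^sub>E UNIV \<and> F (\<lambda>e. f e - g e)}"
    and "c \<equiv> (1 - a) * (1 - b)" and "D \<equiv> a + b + (of_nat CARD('a) - 2) * (a * b)"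
  shows "(\<Sum>(f, g)\<in>P. (\<Prod>e\<in>E. (if f e \<noteq> 0 then a else 1) * (if g e \<noteq> 0 then b else 1))) =
    (\<Sum>B\<in>Pow E. c ^ card B * D ^ (card E - card B) *
       of_nat (card {h \<in> E \<rightarrow>\<^sub>E UNIV. F h \<and> (\<forall>e\<in>B. h e = 0)}))"
proof -
  let ?U = "E \<rightarrow>\<^sub>E (UNIV :: 'a set)"
  let ?F = "{h \<in> ?U. F h}"
  have finU: "finite ?U" using E by (auto intro!: finite_PiE)
  \<comment> \<open>Sums and differences of extensional functions need not be extensional, so the
    bijection of pairs below has to restrict them.\<close>
  have r: "F (restrict h E) = F h" for h by (rule F) auto
  let ?u = "\<lambda>h g e. (if h e + g e \<noteq> 0 then a else 1) * (if g e \<noteq> 0 then b else 1)"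
  have "(\<Sum>(f, g)\<in>P. (\<Prod>e\<in>E. (if f e \<noteq> 0 then a else 1) * (if g e \<noteq> 0 then b else 1))) =
      (\<Sum>(h, g)\<in>?F \<times> ?U. \<Prod>e\<in>E. ?u h g e)"
    by (rule sum.reindex_bij_witness[of _ "\<lambda>(h, g). (restrict (\<lambda>e. h e + g e) E, g)"
          "\<lambda>(f, g). (restrict (\<lambda>e. f e - g e) E, g)"])
      (auto simp: P_def r fun_eq_iff PiE_def extensional_def intro!: prod.cong intro: F[THEN iffD1, rotated])
  also have "\<dots> = (\<Sum>h\<in>?F. \<Sum>g\<in>?U. \<Prod>e\<in>E. ?u h g e)"
    by (rule sum.cartesian_product[symmetric])
  also have "\<dots> = (\<Sum>h\<in>?F. \<Prod>e\<in>E. (if h e = 0 then c else 0) + D)"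
  proof (intro sum.cong refl)
    fix h :: "nat \<Rightarrow> 'a"
    have "(\<Sum>g\<in>?U. \<Prod>e\<in>E. ?u h g e) =
        (\<Prod>e\<in>E. \<Sum>y\<in>UNIV. (if h e + y \<noteq> 0 then a else 1) * (if y \<noteq> 0 then b else 1))"
      by (rule prod_sum_PiE[symmetric]) (use E in auto)
    thus "(\<Sum>g\<in>?U. \<Prod>e\<in>E. ?u h g e) = (\<Prod>e\<in>E. (if h e = 0 then c else 0) + D)"
      unfolding sum_pair_weights c_def D_def .
  qed
  also have "\<dots> = (\<Sum>h\<in>?F. \<Sum>B\<in>Pow E. c ^ card B * D ^ (card E - card B) * of_bool (\<forall>e\<in>B. h e = 0))"
  proof (intro sum.cong refl)
    fix h :: "nat \<Rightarrow> 'a"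
    have "(\<Prod>e\<in>B. if h e = 0 then c else 0) = c ^ card B * of_bool (\<forall>e\<in>B. h e = 0)"
      if "B \<subseteq> E" for B
    proof (cases "\<forall>e\<in>B. h e = 0")
      case False
      thus ?thesis using finite_subset[OF that E] by (auto intro!: prod_zero)
    qed simp
    thus "(\<Prod>e\<in>E. (if h e = 0 then c else 0) + D) =
        (\<Sum>B\<in>Pow E. c ^ card B * D ^ (card E - card B) * of_bool (\<forall>e\<in>B. h e = 0))"
      unfolding prod_add[OF E] using E
      by (intro sum.cong) (auto simp: card_Diff_subset finite_subset)
  qed
  also have "\<dots> = (\<Sum>B\<in>Pow E. c ^ card B * D ^ (card E - card B) * (\<Sum>h\<in>?F. of_bool (\<forall>e\<in>B. h e = 0)))"
    by (subst sum.swap) (simp add: sum_distrib_left)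
  also have "(\<lambda>B. \<Sum>h\<in>?F. of_bool (\<forall>e\<in>B. h e = 0) :: complex) =
      (\<lambda>B. of_nat (card {h \<in> ?U. F h \<and> (\<forall>e\<in>B. h e = 0)}))"
    using finU by (intro ext) (simp add: sum_of_bool_eq Int_def conj_ac)
  finally show ?thesis .
qed

text \<open>Makes the product of \<open>1 - \<omega> powi \<alpha>\<close> and
  \<open>1 - \<omega> powi \<beta>\<close>, by which an argument of the polynomial divides, nonzero.
  The exponent is reduced modulo \<sigma> to one strictly between 0 and \<sigma>.\<close>

lemma primitive_root_powi_neq_1:
  assumes "\<sigma> > 1" "primitive_root_of_unity \<sigma> \<omega>" "\<not> [\<alpha> = 0] (mod int \<sigma>)"
  shows "\<omega> powi \<alpha> \<noteq> 1"
proof -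
  have \<omega>\<sigma>: "\<omega> ^ \<sigma> = 1" using assms by (simp add: primitive_root_of_unity_def)
  hence \<omega>0: "\<omega> \<noteq> 0" using assms(1) by (auto simp: power_0_left)
  define m where "m = nat (\<alpha> mod int \<sigma>)"
  have "\<omega> powi \<alpha> = \<omega> powi (int \<sigma> * (\<alpha> div int \<sigma>) + \<alpha> mod int \<sigma>)" by simp
  also have "\<dots> = (\<omega> powi int \<sigma>) powi (\<alpha> div int \<sigma>) * \<omega> powi (\<alpha> mod int \<sigma>)"
    using \<omega>0 by (simp only: power_int_add power_int_mult simp_thms)
  also have "\<dots> = \<omega> powi int m" using \<omega>\<sigma> assms(1) by (simp add: m_def)
  finally have "\<omega> powi \<alpha> = \<omega> ^ m" by simp
  moreover have "0 < m" "m < \<sigma>"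
    using assms(1,3) pos_mod_sign[of "int \<sigma>" \<alpha>] pos_mod_bound[of "int \<sigma>" \<alpha>]
    by (auto simp: m_def cong_def nat_less_iff order.order_iff_strict)
  ultimately show ?thesis using assms(2) by (simp add: primitive_root_of_unity_def)
qed

text \<open>The sums agree term by term: the prefactor clears the denominators of both arguments.
  The assumptions \<open>rk\<close> keep the subtractions of natural numbers from being
  truncated.\<close>

lemma rank_gen_poly_eq:
  fixes c D :: complex
  assumes E: "finite E" and c: "c \<noteq> 0" and D: "D \<noteq> 0"
    and rk: "\<And>B. B \<subseteq> E \<Longrightarrow> matroid_rank ind B \<le> matroid_rank ind E"
      "\<And>B. B \<subseteq> E \<Longrightarrow> matroid_rank ind B \<le> card B"
  shows "c ^ matroid_rank ind E * D ^ (card E - matroid_rank ind E) *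
      rank_gen_poly E ind (of_nat q * D / c) (c / D) =
    (\<Sum>B\<in>Pow E. c ^ card B * D ^ (card E - card B) *
      of_nat (q ^ (matroid_rank ind E - matroid_rank ind B)))"
  unfolding rank_gen_poly_def sum_distrib_left
proof (intro sum.cong refl)
  fix B assume "B \<in> Pow E"
  hence B: "B \<subseteq> E" "card B \<le> card E" using E by (auto intro: card_mono)
  let ?r = "matroid_rank ind E" and ?s = "matroid_rank ind B"
  have le: "?s \<le> ?r" "?s \<le> card B" "?r \<le> card E" using rk B(1) by auto
  define t m n where "t = ?r - ?s" and "m = card B - ?s" and "n = card E - card B"
  have eqs: "?r = ?s + t" "card B = ?s + m" "card E - ?r + t = m + n" "card E = ?s + m + n"
    using le B(2) by (auto simp: t_def m_def n_def)
  have "c ^ ?r * D ^ (card E - ?r) * ((of_nat q * D / c) ^ t * (c / D) ^ m) =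
      of_nat q ^ t * (c ^ (?s + t) / c ^ t * c ^ m) * (D ^ (card E - ?r + t) / D ^ m)"
    using eqs(1) by (simp add: power_divide power_mult_distrib power_add field_simps)
  also have "\<dots> = c ^ card B * D ^ n * of_nat (q ^ t)"
    unfolding eqs(3) eqs(2) using c D by (simp add: power_add)
  finally show "c ^ ?r * D ^ (card E - ?r) * ((of_nat q * D / c) ^ (?r - ?s) * (c / D) ^ (card B - ?s)) =
      c ^ card B * D ^ (card E - card B) * of_nat (q ^ (?r - ?s))"
    by (simp add: t_def m_def n_def)
qed

section \<open>Regularity of the admissible matrices\<close>

lemma submatrix_map_mat:
  assumes "J \<subseteq> {..<dim_row G}" "I \<subseteq> {..<dim_col G}"
  shows "submatrix (map_mat f G) J I = map_mat f (submatrix G J I)"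
proof (rule eq_matI)
  fix a b assume "a < dim_row (map_mat f (submatrix G J I))" "b < dim_col (map_mat f (submatrix G J I))"
  hence ab: "a < card J" "b < card I" using assms by (auto simp: submatrix_eq_mat)
  hence "pick J a < dim_row G" "pick I b < dim_col G"
    using assms pick_in_set_le[OF ab(1)] pick_in_set_le[OF ab(2)] by auto
  thus "submatrix (map_mat f G) J I $$ (a, b) = map_mat f (submatrix G J I) $$ (a, b)"
    using ab assms by (simp add: submatrix_eq_mat)
qed (use assms in \<open>simp_all add: submatrix_eq_mat\<close>)

text \<open>A row of the adjugate of a nonsingular minor, divided by the determinant, is a row of
  the left inverse.\<close>

lemma regular_matrix_field:
  fixes G :: "'k::field mat"
  shows "regular_matrix (\<lambda>x. x) G"
  unfolding regular_matrix_def split_columns_def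
proof (intro allI impI ballI)
  fix I i assume "indep_columns (map_mat (\<lambda>x. x) G) I" and i: "i \<in> I"
  moreover have "map_mat (\<lambda>x. x) G = G" by (rule eq_matI) auto
  ultimately have ind: "indep_columns G I" by simp
  hence I: "I \<subseteq> {..<dim_col G}" by (simp add: indep_columns_def)
  obtain J where J: "J \<subseteq> {..<dim_row G}" "card J = card I" "det (submatrix G J I) \<noteq> 0"
    using ind by (rule indep_columns_nonsingular_minor)
  obtain y where y: "\<And>j. j \<in> I \<Longrightarrow>
      (\<Sum>v<dim_row G. y v * G $$ (v, j)) = of_bool (j = i) * det (submatrix G J I)"
    using submatrix_det_dual_row[OF J(1) I J(2) i] by blast
  have "(\<Sum>v<dim_row G. y v / det (submatrix G J I) * G $$ (v, j)) = of_bool (j = i)"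
    if "j \<in> I" for j
    using y[OF that] J(3) by (simp add: field_simps flip: sum_divide_distrib)
  thus "\<exists>y. \<forall>j\<in>I. (\<Sum>v<dim_row G. y v * G $$ (v, j)) = of_bool (j = i)"
    by (intro exI[of _ "\<lambda>v. y v / det (submatrix G J I)"]) blast
qed

lemma split_columns_field:
  fixes G :: "'k::field mat"
  assumes "indep_columns G I"
  shows "split_columns G I"
proof -
  have "map_mat (\<lambda>x. x) G = G" by (rule eq_matI) auto
  thus ?thesis using regular_matrix_field[of G] assms by (simp add: regular_matrix_def)
qed

lemma inj_hom_to_field_of_int: "inj_hom_to_field rat_of_int"
  by unfold_locales auto

lemma inj_hom_to_field_ident: "inj_hom_to_field (\<lambda>x :: 'k::field. x)"
  by unfold_locales auto

text \<open>A minor that is nonzero over the rationals is 1 or -1, hence its own inverse, and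
  multiplication by it replaces division.\<close>

lemma totally_unimodular_regular:
  assumes tu: "totally_unimodular G"
  shows "regular_matrix rat_of_int G"
  unfolding regular_matrix_def split_columns_def
proof (intro allI impI ballI)
  fix I i assume ind: "indep_columns (rat_mat G) I" and i: "i \<in> I"
  hence I: "I \<subseteq> {..<dim_col G}" by (simp add: indep_columns_def)
  obtain J where J: "J \<subseteq> {..<dim_row G}" "card J = card I" "det (submatrix (rat_mat G) J I) \<noteq> 0"
    using indep_columns_nonsingular_minor[OF ind] by auto
  define d where "d = det (submatrix G J I)"
  have "det (submatrix (rat_mat G) J I) = rat_of_int d"
    by (simp add: submatrix_map_mat[OF J(1) I] d_def)
  moreover have "d \<in> {-1, 0, 1}"
    using tu J I unfolding totally_unimodular_def d_def by blast
  ultimately have dd: "d * d = 1" using J(3) by auto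
  obtain y where y: "\<And>j. j \<in> I \<Longrightarrow> (\<Sum>v<dim_row G. y v * G $$ (v, j)) = of_bool (j = i) * d"
    using submatrix_det_dual_row[OF J(1) I J(2) i] unfolding d_def by blast
  have "(\<Sum>v<dim_row G. d * y v * G $$ (v, j)) = of_bool (j = i)" if "j \<in> I" for j
  proof -
    have "(\<Sum>v<dim_row G. d * y v * G $$ (v, j)) = d * (\<Sum>v<dim_row G. y v * G $$ (v, j))"
      by (simp add: sum_distrib_left mult.assoc)
    thus ?thesis using y[OF that] dd by simp
  qed
  thus "\<exists>y. \<forall>j\<in>I. (\<Sum>v<dim_row G. y v * G $$ (v, j)) = of_bool (j = i)"
    by (intro exI[of _ "\<lambda>v. d * y v"]) blast
qed

text \<open>
  Along the edges of \<open>I\<close> a rational dual row is a potential with differences \<open>0\<close> or \<open>1\<close>, and taking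
  integer parts of a potential preserves integral differences.
\<close>

lemma vertex_edge_matrix_regular:
  assumes "vertex_edge_matrix G"
  shows "regular_matrix rat_of_int G"
  unfolding regular_matrix_def split_columns_def
proof (intro allI impI ballI)
  fix I i assume ind: "indep_columns (rat_mat G) I" and i: "i \<in> I"
  hence I: "I \<subseteq> {..<dim_col G}" by (simp add: indep_columns_def)
  obtain \<Gamma> :: "(nat, nat) pre_digraph" where \<Gamma>: "fin_digraph \<Gamma>" "verts \<Gamma> = {..<dim_row G}"
      "arcs \<Gamma> = {..<dim_col G}" and
    G: "\<And>v e. v < dim_row G \<Longrightarrow> e < dim_col G \<Longrightarrow>
      G $$ (v, e) = of_bool (head \<Gamma> e = v) - of_bool (tail \<Gamma> e = v)"
    using assms unfolding vertex_edge_matrix_def by blast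
  interpret fin_digraph \<Gamma> by fact
  have ends: "head \<Gamma> e < dim_row G" "tail \<Gamma> e < dim_row G" if "e \<in> I" for e
    using that I \<Gamma> head_in_verts[of e] tail_in_verts[of e] by auto
  obtain y where y: "\<And>j. j \<in> I \<Longrightarrow> (\<Sum>v<dim_row G. y v * rat_mat G $$ (v, j)) = of_bool (j = i)"
    using bspec[OF split_columns_field[OF ind, unfolded split_columns_def] i] by force
  \<comment> \<open>Stated for every commutative ring, since it is applied to the rational potential
    and to its integer part. A loop gives 0 on both sides.\<close>
  have diff: "(\<Sum>v<dim_row G. w v * (of_bool (head \<Gamma> j = v) - of_bool (tail \<Gamma> j = v))) =
      w (head \<Gamma> j) - w (tail \<Gamma> j)" if "j \<in> I" for w :: "nat \<Rightarrow> 'b::comm_ring_1" and j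
  proof -
    have "(\<Sum>v<dim_row G. w v * of_bool (u = v)) = w u" if "u < dim_row G" for u
    proof -
      have "(\<Sum>v<dim_row G. w v * of_bool (u = v)) = (\<Sum>v<dim_row G. if v = u then w v else 0)"
        by (intro sum.cong) auto
      thus ?thesis using that by simp
    qed
    thus ?thesis using ends[OF that] by (simp add: right_diff_distrib sum_subtractf)
  qed
  have "(\<Sum>v<dim_row G. \<lfloor>y v\<rfloor> * G $$ (v, j)) = of_bool (j = i)" if j: "j \<in> I" for j
  proof -
    have jc: "j < dim_col G" using j I by auto
    have "of_bool (j = i) = (\<Sum>v<dim_row G. y v * (of_bool (head \<Gamma> j = v) - of_bool (tail \<Gamma> j = v)))"
      unfolding y[OF j, symmetric] using jc by (intro sum.cong) (auto simp: G)
    hence "y (head \<Gamma> j) = y (tail \<Gamma> j) + of_int (of_bool (j = i))" using diff[OF j, of y] by simp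
    hence "\<lfloor>y (head \<Gamma> j)\<rfloor> = \<lfloor>y (tail \<Gamma> j)\<rfloor> + of_bool (j = i)" by (simp only: floor_add_int)
    moreover have "(\<Sum>v<dim_row G. \<lfloor>y v\<rfloor> * G $$ (v, j)) =
        (\<Sum>v<dim_row G. \<lfloor>y v\<rfloor> * (of_bool (head \<Gamma> j = v) - of_bool (tail \<Gamma> j = v)))"
      using jc by (intro sum.cong) (auto simp: G)
    ultimately show ?thesis using diff[OF j, of "\<lambda>v. \<lfloor>y v\<rfloor>"] by simp
  qed
  thus "\<exists>y. \<forall>j\<in>I. (\<Sum>v<dim_row G. y v * G $$ (v, j)) = of_bool (j = i)"
    by (intro exI[of _ "\<lambda>v. \<lfloor>y v\<rfloor>"]) blast
qed

section \<open>Circulations and cycles of a graph\<close>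

lemma two_way_simps:
  "verts (two_way \<Gamma>) = verts \<Gamma>" "arcs (two_way \<Gamma>) = arcs \<Gamma> \<times> UNIV"
  "tail (two_way \<Gamma>) (e, d) = (if d then tail \<Gamma> e else head \<Gamma> e)"
  "head (two_way \<Gamma>) (e, d) = (if d then head \<Gamma> e else tail \<Gamma> e)"
  by (simp_all add: two_way_def)

lemma (in pre_digraph) sum_list_potential_differences:
  fixes w :: "'a \<Rightarrow> 'c::ab_group_add"
  assumes "cas u p v"
  shows "(\<Sum>e\<leftarrow>p. w (head G e) - w (tail G e)) = w v - w u"
  using assms by (induction p arbitrary: u) auto

text \<open>Potential differences telescope along a closed walk. Being a circulation is expressed as
  orthogonality to all potential differences, which suits both this telescoping and the later test
  with the indicator of a cut.\<close>

lemma undirected_cycle_circulation: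
  fixes w :: "'v \<Rightarrow> 'c::comm_ring_1"
  assumes cyc: "undirected_cycle \<Gamma> c" and fin: "finite (arcs \<Gamma>)"
  shows "(\<Sum>e\<in>arcs \<Gamma>. (of_bool ((e, True) \<in> set c) - of_bool ((e, False) \<in> set c)) *
    (w (head \<Gamma> e) - w (tail \<Gamma> e))) = 0"
proof -
  interpret T: pre_digraph "two_way \<Gamma>" .
  let ?d = "\<lambda>a. w (head (two_way \<Gamma>) a) - w (tail (two_way \<Gamma>) a)"
  obtain u where u: "T.awalk u c u" using cyc by (auto simp: undirected_cycle_def T.cycle_def)
  have dist: "distinct c" using cyc by (auto simp: undirected_cycle_def distinct_map)
  have sub: "set c \<subseteq> arcs \<Gamma> \<times> UNIV" using u by (simp add: T.awalk_def two_way_simps)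
  have "(\<Sum>a\<in>set c. ?d a) = (\<Sum>a\<leftarrow>c. ?d a)" using dist by (simp add: sum_list_distinct_conv_sum_set)
  also have "\<dots> = 0" using T.sum_list_potential_differences[of u c u w] u by (simp add: T.awalk_def)
  also have "(\<Sum>a\<in>set c. ?d a) = (\<Sum>a\<in>arcs \<Gamma> \<times> UNIV. of_bool (a \<in> set c) * ?d a)"
    using sub fin by (intro sum.mono_neutral_cong_left) auto
  also have "\<dots> = (\<Sum>e\<in>arcs \<Gamma>. \<Sum>d\<in>UNIV. of_bool ((e, d) \<in> set c) * ?d (e, d))"
    unfolding sum.cartesian_product by (rule sum.cong) auto
  also have "\<dots> = (\<Sum>e\<in>arcs \<Gamma>. (of_bool ((e, True) \<in> set c) - of_bool ((e, False) \<in> set c)) *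
    (w (head \<Gamma> e) - w (tail \<Gamma> e)))"
    by (intro sum.cong) (auto simp: UNIV_bool two_way_simps algebra_simps)
  finally show ?thesis .
qed

text \<open>
  If an edge \<open>i\<close> of the support of a circulation \<open>z\<close> were in no cycle of the support, the vertices
  reachable from the head of \<open>i\<close> without using \<open>i\<close> would form a cut meeting the support only in \<open>i\<close>.
\<close>

lemma circulation_support_cycle:
  fixes z :: "'e \<Rightarrow> 'c::comm_ring_1"
  assumes "fin_digraph \<Gamma>" and i: "i \<in> arcs \<Gamma>" "z i \<noteq> 0"
    and circ: "\<And>w :: 'v \<Rightarrow> 'c. (\<Sum>e\<in>arcs \<Gamma>. z e * (w (head \<Gamma> e) - w (tail \<Gamma> e))) = 0"
  obtains c where "undirected_cycle \<Gamma> c" "i \<in> fst ` set c" "\<And>e. e \<in> fst ` set c \<Longrightarrow> z e \<noteq> 0"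
proof -
  interpret \<Gamma>: fin_digraph \<Gamma> by fact
  define \<Delta> where "\<Delta> = two_way \<Gamma>\<lparr>arcs := {e \<in> arcs \<Gamma>. z e \<noteq> 0 \<and> e \<noteq> i} \<times> UNIV\<rparr>"
  have \<Delta>: "verts \<Delta> = verts \<Gamma>" "arcs \<Delta> = {e \<in> arcs \<Gamma>. z e \<noteq> 0 \<and> e \<noteq> i} \<times> UNIV"
    "tail \<Delta> = tail (two_way \<Gamma>)" "head \<Delta> = head (two_way \<Gamma>)"
    by (simp_all add: \<Delta>_def two_way_def)
  interpret \<Delta>: wf_digraph \<Delta>
    by unfold_locales (auto simp: \<Delta> two_way_simps split: if_splits)
  interpret T: pre_digraph "two_way \<Gamma>" .
  define S where "S = {v. head \<Gamma> i \<rightarrow>\<^sup>*\<^bsub>\<Delta>\<^esub> v}"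
  have arc: "head \<Delta> (e, d) \<in> S" if "tail \<Delta> (e, d) \<in> S" "(e, d) \<in> arcs \<Delta>" for e d
    using that \<Delta>.reachable_arc_trans[of "head \<Gamma> i" "tail \<Delta> (e, d)" "(e, d)" "head \<Delta> (e, d)"]
    by (simp add: S_def \<Delta>.arc_def)
  have hi: "head \<Gamma> i \<in> S" using i by (simp add: S_def \<Delta>)
  have ti: "tail \<Gamma> i \<in> S"
  proof (rule ccontr)
    assume ti: "tail \<Gamma> i \<notin> S"
    \<comment> \<open>With the indicator of \<open>S\<close> as potential only \<open>i\<close>
      contributes: any other edge of the support is in \<open>\<Delta>\<close> in both directions,
      so its ends lie on the same side.\<close>
    define w :: "'v \<Rightarrow> 'c" where "w v = of_bool (v \<in> S)" for v
    have "z e * (w (head \<Gamma> e) - w (tail \<Gamma> e)) = 0" if e: "e \<in> arcs \<Gamma> - {i}" for e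
    proof (cases "z e = 0")
      case False
      hence "(e, d) \<in> arcs \<Delta>" for d using e by (simp add: \<Delta>)
      hence "head \<Gamma> e \<in> S \<longleftrightarrow> tail \<Gamma> e \<in> S"
        using arc[of e True] arc[of e False] by (auto simp: \<Delta> two_way_simps)
      thus ?thesis by (simp add: w_def)
    qed simp
    hence "(\<Sum>e\<in>arcs \<Gamma>. z e * (w (head \<Gamma> e) - w (tail \<Gamma> e))) = z i * (w (head \<Gamma> i) - w (tail \<Gamma> i))"
      using i by (subst sum.remove[of _ i]) auto
    thus False using circ[of w] hi ti i by (simp add: w_def)
  qed
  then obtain p where p: "\<Delta>.apath (head \<Gamma> i) p (tail \<Gamma> i)"
    by (auto simp: S_def \<Delta>.reachable_apath)
  have cas: "\<Delta>.cas u q v = T.cas u q v" for u q v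
    by (induction q arbitrary: u) (simp_all add: T.cas.simps \<Delta>.cas.simps \<Delta>)
  have verts: "\<Delta>.awalk_verts u q = T.awalk_verts u q" for u q
    by (induction q arbitrary: u) (simp_all add: \<Delta>)
  \<comment> \<open>A path never returns to the tail of its first arc, whereas a later arc with the
    same edge, in either direction, would touch that vertex.\<close>
  have distinct: "distinct (map fst q)" if "\<Delta>.apath u q v" for u q v
    using that
  proof (induction q arbitrary: u)
    case (Cons a q)
    hence q: "\<Delta>.apath (head \<Delta> a) q v" and new: "tail \<Delta> a \<notin> set (\<Delta>.awalk_verts (head \<Delta> a) q)"
      by (auto simp: \<Delta>.apath_Cons_iff)
    have "fst a \<notin> fst ` set q"
    proof
      assume "fst a \<in> fst ` set q"
      then obtain b where b: "b \<in> set q" "fst b = fst a" by auto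
      have "\<Delta>.awalk (head \<Delta> a) q v" using q by (simp add: \<Delta>.apath_def)
      hence "tail \<Delta> b \<in> set (\<Delta>.awalk_verts (head \<Delta> a) q)" "head \<Delta> b \<in> set (\<Delta>.awalk_verts (head \<Delta> a) q)"
        using b(1) \<Delta>.awalk_verts_arc1 \<Delta>.awalk_verts_arc2 by blast+
      moreover have "tail \<Delta> a = tail \<Delta> b \<or> tail \<Delta> a = head \<Delta> b"
        using b(2) by (cases a; cases b) (auto simp: \<Delta> two_way_simps)
      ultimately show False using new by metis
    qed
    thus ?case using Cons.IH[OF q] by simp
  qed simp
  have walk: "\<Delta>.awalk (head \<Gamma> i) p (tail \<Gamma> i)" using p by (simp add: \<Delta>.apath_def)
  have ps: "set p \<subseteq> {e \<in> arcs \<Gamma>. z e \<noteq> 0 \<and> e \<noteq> i} \<times> UNIV"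
    using walk by (simp add: \<Delta>.awalk_def \<Delta>)
  \<comment> \<open>The path from the head of \<open>i\<close> back to its tail is closed by
    \<open>i\<close> itself; for a loop the path is empty.\<close>
  define c where "c = (i, True) # p"
  have "T.awalk (tail \<Gamma> i) c (tail \<Gamma> i)"
    using walk ps i by (auto simp: c_def T.awalk_def \<Delta>.awalk_def two_way_simps T.cas.simps cas)
  moreover have "distinct (tl (T.awalk_verts (tail \<Gamma> i) c))"
    using p by (simp add: c_def two_way_simps \<Delta>.apath_def verts)
  ultimately have "T.cycle c" unfolding T.cycle_def by (auto simp: c_def)
  moreover have "distinct (map fst c)" using distinct[OF p] ps by (auto simp: c_def)
  ultimately have "undirected_cycle \<Gamma> c" by (simp add: undirected_cycle_def)
  moreover have "i \<in> fst ` set c" by (simp add: c_def)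
  moreover have "z e \<noteq> 0" if "e \<in> fst ` set c" for e using that ps i by (auto simp: c_def)
  ultimately show thesis using that by blast
qed

text \<open>A rational dual row combines the rows of \<open>G\<close> to a circulation
  \<open>z\<close> that is 1 at \<open>i\<close> and 0 on the rest of \<open>I\<close>. A cycle
  through \<open>i\<close> within the support of \<open>z\<close> then meets \<open>I\<close> only
  in \<open>i\<close>, and its own row of \<open>G\<close>, up to sign, is the integral dual
  row.\<close>

lemma cycle_edge_matrix_regular:
  assumes "cycle_edge_matrix G"
  shows "regular_matrix rat_of_int G"
  unfolding regular_matrix_def split_columns_def
proof (intro allI impI ballI)
  fix I i assume ind: "indep_columns (rat_mat G) I" and i: "i \<in> I"
  hence I: "I \<subseteq> {..<dim_col G}" by (simp add: indep_columns_def)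
  obtain \<Gamma> :: "(nat, nat) pre_digraph" where \<Gamma>: "fin_digraph \<Gamma>" "arcs \<Gamma> = {..<dim_col G}" and
    rows: "\<forall>r<dim_row G. \<exists>c. undirected_cycle \<Gamma> c \<and> (\<forall>e<dim_col G.
      G $$ (r, e) = of_bool ((e, True) \<in> set c) - of_bool ((e, False) \<in> set c))" and
    cycles: "\<forall>c. undirected_cycle \<Gamma> c \<longrightarrow>
      (\<exists>!r. r < dim_row G \<and> {e. e < dim_col G \<and> G $$ (r, e) \<noteq> 0} = fst ` set c)"
    using assms unfolding cycle_edge_matrix_def by (elim exE conjE)
  obtain y where y: "\<And>j. j \<in> I \<Longrightarrow> (\<Sum>v<dim_row G. y v * rat_mat G $$ (v, j)) = of_bool (j = i)"
    using bspec[OF split_columns_field[OF ind, unfolded split_columns_def] i] by force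
  define z where "z e = (\<Sum>v<dim_row G. y v * rat_of_int (G $$ (v, e)))" for e
  have z: "z j = of_bool (j = i)" if "j \<in> I" for j
  proof -
    have "z j = (\<Sum>v<dim_row G. y v * rat_mat G $$ (v, j))"
      unfolding z_def using that I by (intro sum.cong) auto
    thus ?thesis using y[OF that] by simp
  qed
  have circ: "(\<Sum>e\<in>arcs \<Gamma>. z e * (w (head \<Gamma> e) - w (tail \<Gamma> e))) = 0" for w :: "nat \<Rightarrow> rat"
  proof -
    have row: "(\<Sum>e\<in>arcs \<Gamma>. rat_of_int (G $$ (v, e)) * (w (head \<Gamma> e) - w (tail \<Gamma> e))) = 0"
      if v: "v < dim_row G" for v
    proof -
      obtain c where c: "undirected_cycle \<Gamma> c"
        "\<And>e. e < dim_col G \<Longrightarrow> G $$ (v, e) = of_bool ((e, True) \<in> set c) - of_bool ((e, False) \<in> set c)"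
        using rows v by blast
      have "(\<Sum>e\<in>arcs \<Gamma>. rat_of_int (G $$ (v, e)) * (w (head \<Gamma> e) - w (tail \<Gamma> e))) =
          (\<Sum>e\<in>arcs \<Gamma>. (of_bool ((e, True) \<in> set c) - of_bool ((e, False) \<in> set c)) *
            (w (head \<Gamma> e) - w (tail \<Gamma> e)))"
        using c(2) \<Gamma>(2) by (intro sum.cong) auto
      thus ?thesis using undirected_cycle_circulation[OF c(1), of w] \<Gamma>(2) by simp
    qed
    have "(\<Sum>e\<in>arcs \<Gamma>. z e * (w (head \<Gamma> e) - w (tail \<Gamma> e))) = (\<Sum>v<dim_row G. y v *
        (\<Sum>e\<in>arcs \<Gamma>. rat_of_int (G $$ (v, e)) * (w (head \<Gamma> e) - w (tail \<Gamma> e))))"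
      unfolding z_def sum_distrib_left sum_distrib_right by (subst sum.swap) (simp add: mult.assoc)
    also have "\<dots> = 0" using row by simp
    finally show ?thesis .
  qed
  have iE: "i \<in> arcs \<Gamma>" using i I \<Gamma>(2) by auto
  have zi: "z i \<noteq> 0" using z[OF i] by simp
  obtain c where c: "undirected_cycle \<Gamma> c" "i \<in> fst ` set c" "\<And>e. e \<in> fst ` set c \<Longrightarrow> z e \<noteq> 0"
    using circulation_support_cycle[OF \<Gamma>(1) iE zi circ] by blast
  \<comment> \<open>Every cycle has a row with the same edge set; its orientation may differ, hence
    the sign \<open>G $$ (r, i)\<close> below.\<close>
  obtain r where r: "r < dim_row G" "{e. e < dim_col G \<and> G $$ (r, e) \<noteq> 0} = fst ` set c"
    using ex1_implies_ex[OF cycles[rule_format, OF c(1)]] by blast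
  have iG: "i < dim_col G" using i I by auto
  hence "G $$ (r, i) \<noteq> 0" using r(2) c(2) by blast
  moreover have "G $$ (r, i) \<in> {-1, 0, 1}"
  proof -
    obtain c' where "G $$ (r, i) = of_bool ((i, True) \<in> set c') - of_bool ((i, False) \<in> set c')"
      using rows r(1) iG by blast
    thus ?thesis by (cases "(i, True) \<in> set c'"; cases "(i, False) \<in> set c'") auto
  qed
  ultimately have sq: "G $$ (r, i) * G $$ (r, i) = 1" by auto
  have other: "G $$ (r, j) = 0" if "j \<in> I" "j \<noteq> i" for j
    using r(2) c(3)[of j] z[of j] that I by auto
  define x where "x v = (if v = r then G $$ (r, i) else 0)" for v
  have "(\<Sum>v<dim_row G. x v * G $$ (v, j)) = of_bool (j = i)" if j: "j \<in> I" for j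
  proof -
    have "(\<Sum>v<dim_row G. x v * G $$ (v, j)) = (\<Sum>v<dim_row G. if v = r then G $$ (r, i) * G $$ (r, j) else 0)"
      by (intro sum.cong) (auto simp: x_def)
    thus ?thesis using r(1) sq other[OF j] by auto
  qed
  thus "\<exists>y. \<forall>j\<in>I. (\<Sum>v<dim_row G. y v * G $$ (v, j)) = of_bool (j = i)" by blast
qed

lemma graphic_or_unimodular_regular:
  "graphic_or_unimodular G \<Longrightarrow> regular_matrix rat_of_int G"
  unfolding graphic_or_unimodular_def
  using vertex_edge_matrix_regular cycle_edge_matrix_regular totally_unimodular_regular by blast

section \<open>The main theorem\<close>

lemma int_scale_step: "int_scale (k + 1) x = int_scale k x + x"
proof (cases "0 \<le> k")
  case True
  hence "nat (k + 1) = Suc (nat k)" by simp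
  thus ?thesis using True by (simp add: int_scale_def)
next
  case False
  hence "nat (- k) = Suc (nat (- (k + 1)))" by simp
  thus ?thesis using False by (auto simp: int_scale_def)
qed

lemma int_scale_0: "int_scale 0 x = 0"
  by (simp add: int_scale_def)

lemma int_scale_1: "int_scale 1 x = x"
  by (simp add: int_scale_def)

lemma int_scale_add_left: "int_scale (k + l) x = int_scale k x + int_scale l x"
proof (induction l rule: int_induct[where k = 0])
  case (step1 l)
  have "int_scale (k + (l + 1)) x = int_scale (k + l) x + x"
    using int_scale_step[of "k + l" x] by (simp add: add.assoc)
  thus ?case using step1 int_scale_step[of l x] by (simp add: add.assoc)
next
  case (step2 l)
  have "int_scale (k + l) x = int_scale (k + (l - 1)) x + x" "int_scale l x = int_scale (l - 1) x + x"
    using int_scale_step[of "k + (l - 1)" x] int_scale_step[of "l - 1" x] by (simp_all add: algebra_simps)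
  thus ?case using step2 by (simp add: add.assoc[symmetric])
qed (simp add: int_scale_0)

text \<open>Abelian groups as modules over the integers: this puts them under the same flow lemmas
  as the vector spaces \<open>'k ^ 'd\<close>.\<close>

lemma module_int_scale: "Modules.module int_scale"
proof
  fix a b :: int and x y :: 'a
  show "int_scale a (x + y) = int_scale a x + int_scale a y"
    by (simp add: int_scale_def sum.distrib)
  show "int_scale (a + b) x = int_scale a x + int_scale b x" by (rule int_scale_add_left)
  show "int_scale a (int_scale b x) = int_scale (a * b) x"
  proof (induction a rule: int_induct[where k = 0])
    case (step1 a)
    thus ?case by (simp add: int_scale_1 distrib_right int_scale_add_left)
  next
    case (step2 a)
    have "int_scale a (int_scale b x) = int_scale (a - 1) (int_scale b x) + int_scale b x"
      using int_scale_step[of "a - 1" "int_scale b x"] by simp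
    moreover have "int_scale (a * b) x = int_scale ((a - 1) * b) x + int_scale b x"
      using int_scale_add_left[of "(a - 1) * b" b x] by (simp add: left_diff_distrib)
    ultimately show ?case using step2 by simp
  qed (simp add: int_scale_0)
  show "int_scale 1 x = x" by (rule int_scale_1)
qed

lemma module_vector_scalar_mult: "Modules.module (vector_scalar_mult :: 'k::field \<Rightarrow> 'k ^ 'd \<Rightarrow> 'k ^ 'd)"
  by unfold_locales (vector algebra_simps)+

text \<open>Common form of both halves of the theorem: the sum over pairs becomes a sum over edge
  sets \<open>B\<close> weighted by the number of flows vanishing on \<open>B\<close>, and the rank
  formula for this number produces the polynomial.\<close>

lemma (in inj_hom_to_field) sum_flow_pairs_row_flow:
  fixes \<omega> :: complex and G :: "'c mat" and act :: "'c \<Rightarrow> 'm::{ab_group_add, finite} \<Rightarrow> 'm"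
  assumes mod: "Modules.module act" and reg: "regular_matrix hom G"
    and \<sigma>: "\<sigma> > 1" and \<alpha>: "\<not> [\<alpha> = 0] (mod int \<sigma>)" and \<beta>: "\<not> [\<beta> = 0] (mod int \<sigma>)"
    and \<omega>: "primitive_root_of_unity \<sigma> \<omega>"
    and D: "D = \<omega> powi \<alpha> + \<omega> powi \<beta> + (of_nat CARD('m) - 2) * \<omega> powi (\<alpha> + \<beta>)" and "D \<noteq> 0"
  defines "r \<equiv> mat_rank (map_mat hom G)"
  shows "(\<Sum>k<\<sigma>. \<omega> ^ k * of_nat (card (flow_pairs {..<dim_col G} (row_flow act G) \<alpha> \<beta> k \<sigma>)))
    = (1 - \<omega> powi \<alpha>) ^ r * (1 - \<omega> powi \<beta>) ^ r * D ^ (dim_col G - r) *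
      matroid_R (map_mat hom G)
        (of_nat CARD('m) * D / ((1 - \<omega> powi \<alpha>) * (1 - \<omega> powi \<beta>)))
        ((1 - \<omega> powi \<alpha>) * (1 - \<omega> powi \<beta>) / D)"
proof -
  let ?E = "{..<dim_col G}" and ?ind = "indep_columns (map_mat hom G)"
  let ?c = "(1 - \<omega> powi \<alpha>) * (1 - \<omega> powi \<beta>)"
  have \<omega>0: "\<omega> \<noteq> 0" using \<omega> \<sigma> by (auto simp: primitive_root_of_unity_def power_0_left)
  have D': "D = \<omega> powi \<alpha> + \<omega> powi \<beta> + (of_nat CARD('m) - 2) * (\<omega> powi \<alpha> * \<omega> powi \<beta>)"
    using D \<omega>0 by (simp add: power_int_add)
  have c: "?c \<noteq> 0"
    using primitive_root_powi_neq_1[OF \<sigma> \<omega>] \<alpha> \<beta> by auto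
  have rE: "matroid_rank ?ind ?E = r"
    using matroid_rank_eq_mat_rank[of "map_mat hom G"] by (simp add: r_def)
  have rk: "matroid_rank ?ind B \<le> matroid_rank ?ind ?E" "matroid_rank ?ind B \<le> card B"
    if B: "B \<subseteq> ?E" for B
  proof -
    obtain I where I: "I \<subseteq> B" "?ind I" "card I = matroid_rank ?ind B" by (rule matroid_rank_witness)
    show "matroid_rank ?ind B \<le> matroid_rank ?ind ?E"
      using card_le_matroid_rank[of I ?E "map_mat hom G"] I B by auto
    show "matroid_rank ?ind B \<le> card B"
      using card_mono[OF finite_subset[OF B] I(1)] I(3) by simp
  qed
  have "(\<Sum>k<\<sigma>. \<omega> ^ k * of_nat (card (flow_pairs ?E (row_flow act G) \<alpha> \<beta> k \<sigma>))) =
      (\<Sum>B\<in>Pow ?E. ?c ^ card B * D ^ (card ?E - card B) *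
        of_nat (card {h \<in> ?E \<rightarrow>\<^sub>E UNIV. row_flow act G h \<and> (\<forall>e\<in>B. h e = 0)}))"
    unfolding sum_flow_pairs[OF \<sigma> \<omega> finite_lessThan] D'
    by (rule sum_pairs_eq_sum_flows[OF finite_lessThan]) (rule row_flow_cong, simp)
  also have "\<dots> = (\<Sum>B\<in>Pow ?E. ?c ^ card B * D ^ (card ?E - card B) *
        of_nat (CARD('m) ^ (matroid_rank ?ind ?E - matroid_rank ?ind B)))"
    using card_row_flows_vanishing[OF mod reg] rE by (intro sum.cong) (auto simp: r_def)
  also have "\<dots> = ?c ^ r * D ^ (card ?E - r) *
      rank_gen_poly ?E ?ind (of_nat CARD('m) * D / ?c) (?c / D)"
    using rank_gen_poly_eq[of ?E ?c D ?ind "CARD('m)"] c \<open>D \<noteq> 0\<close> rk rE by simp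
  finally show ?thesis by (simp add: matroid_R_def power_mult_distrib)
qed

theorem theorem4p1:
  fixes \<sigma> q :: nat and \<alpha> \<beta> :: int and \<omega> D :: complex
  assumes "\<sigma> > 1"
    and "\<not> [\<alpha> = 0] (mod int \<sigma>)"
    and "\<not> [\<beta> = 0] (mod int \<sigma>)"
    and "primitive_root_of_unity \<sigma> \<omega>"
    and D: "D = \<omega> powi \<alpha> + \<omega> powi \<beta> + (of_nat q - 2) * \<omega> powi (\<alpha> + \<beta>)"
    and "D \<noteq> 0"
  shows
    "(\<forall>(G :: int mat) (is_flow :: (nat \<Rightarrow> 'a::{ab_group_add, finite}) \<Rightarrow> bool) r.
        graphic_or_unimodular G \<and> r = mat_rank (rat_mat G) \<and>
        q = CARD('a) \<and> int_flow_notion G is_flow \<longrightarrow>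
        (\<Sum>k<\<sigma>. \<omega> ^ k * of_nat (card (flow_pairs {..<dim_col G} is_flow \<alpha> \<beta> k \<sigma>)))
        = (1 - \<omega> powi \<alpha>) ^ r * (1 - \<omega> powi \<beta>) ^ r * D ^ (dim_col G - r) *
          matroid_R (rat_mat G)
            (of_nat q * D / ((1 - \<omega> powi \<alpha>) * (1 - \<omega> powi \<beta>)))
            ((1 - \<omega> powi \<alpha>) * (1 - \<omega> powi \<beta>) / D))
     \<and>
     (\<forall>(G :: 'k::{field, finite} mat) (is_flow :: (nat \<Rightarrow> 'k ^ 'd) \<Rightarrow> bool) r p s.
        prime p \<and> CARD('k) = p ^ s \<and> r = mat_rank G \<and>
        q = p ^ (s * CARD('d)) \<and> field_flow_notion G is_flow \<longrightarrow>
        (\<Sum>k<\<sigma>. \<omega> ^ k * of_nat (card (flow_pairs {..<dim_col G} is_flow \<alpha> \<beta> k \<sigma>)))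
        = (1 - \<omega> powi \<alpha>) ^ r * (1 - \<omega> powi \<beta>) ^ r * D ^ (dim_col G - r) *
          matroid_R G
            (of_nat q * D / ((1 - \<omega> powi \<alpha>) * (1 - \<omega> powi \<beta>)))
            ((1 - \<omega> powi \<alpha>) * (1 - \<omega> powi \<beta>) / D))"
proof (intro conjI allI impI; elim conjE)
  fix G :: "int mat" and is_flow :: "(nat \<Rightarrow> 'a) \<Rightarrow> bool" and r
  assume G: "graphic_or_unimodular G" and r: "r = mat_rank (rat_mat G)" and q: "q = CARD('a)"
    and flow: "int_flow_notion G is_flow"
  interpret inj_hom_to_field rat_of_int by (rule inj_hom_to_field_of_int)
  \<comment> \<open>The dual \<open>H\<close> belongs to the same classes of matrices as
    \<open>G\<close>, so it is regular as well and its kernel is exactly the set of row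
    flows.\<close>
  have "is_flow = row_flow int_scale G"
    using flow kernel_flow_eq_row_flow[OF module_int_scale graphic_or_unimodular_regular[OF G]]
      graphic_or_unimodular_regular unfolding int_flow_notion_def by blast
  thus "(\<Sum>k<\<sigma>. \<omega> ^ k * of_nat (card (flow_pairs {..<dim_col G} is_flow \<alpha> \<beta> k \<sigma>)))
        = (1 - \<omega> powi \<alpha>) ^ r * (1 - \<omega> powi \<beta>) ^ r * D ^ (dim_col G - r) *
          matroid_R (rat_mat G)
            (of_nat q * D / ((1 - \<omega> powi \<alpha>) * (1 - \<omega> powi \<beta>)))
            ((1 - \<omega> powi \<alpha>) * (1 - \<omega> powi \<beta>) / D)"
    using sum_flow_pairs_row_flow[OF module_int_scale graphic_or_unimodular_regular[OF G]
        assms(1-4) D[unfolded q] assms(6)] unfolding r q by simp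
next
  fix G :: "'k mat" and is_flow :: "(nat \<Rightarrow> 'k ^ 'd) \<Rightarrow> bool" and r p s
  assume k: "CARD('k) = p ^ s" and r: "r = mat_rank G" and q: "q = p ^ (s * CARD('d))"
    and flow: "field_flow_notion G is_flow"
  \<comment> \<open>The order of the group of coordinate vectors is the order of the field to the
    power \<open>CARD('d)\<close>.\<close>
  have q': "q = CARD('k ^ 'd)" using k q by (simp add: power_mult)
  interpret inj_hom_to_field "\<lambda>x :: 'k. x" by (rule inj_hom_to_field_ident)
  have id: "map_mat (\<lambda>x. x) A = A" for A :: "'k mat" by (rule eq_matI) auto
  have "is_flow = row_flow vector_scalar_mult G"
    using flow kernel_flow_eq_row_flow[OF module_vector_scalar_mult regular_matrix_field regular_matrix_field]
    unfolding field_flow_notion_def id by blast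
  thus "(\<Sum>k<\<sigma>. \<omega> ^ k * of_nat (card (flow_pairs {..<dim_col G} is_flow \<alpha> \<beta> k \<sigma>)))
        = (1 - \<omega> powi \<alpha>) ^ r * (1 - \<omega> powi \<beta>) ^ r * D ^ (dim_col G - r) *
          matroid_R G
            (of_nat q * D / ((1 - \<omega> powi \<alpha>) * (1 - \<omega> powi \<beta>)))
            ((1 - \<omega> powi \<alpha>) * (1 - \<omega> powi \<beta>) / D)"
    using sum_flow_pairs_row_flow[OF module_vector_scalar_mult regular_matrix_field
        assms(1-4) D[unfolded q'] assms(6)] unfolding r q' id by simp
qed

end
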